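(* (i) Let $d\ge0$ be an integer and $\lambda_1,\ldots,\lambda_d>0$, and suppose that either $\lambda_0>0$ or $\lambda_0<-(\lambda_1+\cdots+\lambda_d)$. Then, for all $\varepsilon_1,\ldots,\varepsilon_d\in\{\pm1\}$, $$\mathbf g_d(\lambda_0;\lambda_1,\ldots,\lambda_d;\varepsilon_1,\ldots,\varepsilon_d)=\frac1{\sqrt{2\pi}}\int_{-\infty}^{\infty}\prod_{j=1}^d\Phi\Bigl(\varepsilon_j\sqrt{\tfrac{\lambda_j}{\lambda_0}}\,x\Bigr)e^{-x^2/2}\,dx,$$ where for $\lambda_0<0$ the convention $\sqrt{\lambda_0}=i\sqrt{-\lambda_0}$ is used, i.e. $\sqrt{\lambda_j/\lambda_0}:=\sqrt{\lambda_j}/(i\sqrt{-\lambda_0})$. (ii) Let $d\in\mathbb N$ and $k\in\{1,\ldots,d\}$. Suppose that $\lambda_i>0$ for all $i\in\{0,\ldots,d\}\setminus\{k\}$, $\lambda_k<0$, and $\lambda_0+\cdots+\lambda_d<0$. Then, for all $\varepsilon_1,\ldots,\varepsilon_d\in\{\pm1\}$, $$\mathbf g_d(\lambda_0;\lambda_1,\ldots,\lambda_d;\varepsilon_1,\ldots,\varepsilon_d)=\sqrt{\frac{\lambda_0}{2\pi}}\Biggl(\int_0^\infty e^{-\frac{\lambda_0y^2}2}\prod_{\substack{j=1\\ j\ne k}}^d\Phi\bigl(\varepsilon_k\varepsilon_j\sqrt{\lambda_j}\,y\bigr)\,dy+2\int_0^\infty e^{\frac{\lambda_0y^2}2}\,\Phi\bigl(-\sqrt{-\lambda_k}\,y\bigr)\operatorname{Im}\Bigl(\prod_{\substack{j=1\\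 j\ne k}}^d\Phi\bigl(i\varepsilon_k\varepsilon_j\sqrt{\lambda_j}\,y\bigr)\Bigr)dy\Biggr).$$
   Context: $i=\sqrt{-1}$ in the arguments of $\Phi$. $\Phi:\mathbb C\to\mathbb C$ is the entire function $\Phi(z)=\frac12+\frac1{\sqrt{2\pi}}\int_0^ze^{-x^2/2}\,dx$ (integral along any contour from $0$ to $z$), the analytic continuation of the standard normal distribution function. Empty products equal $1$. Function $\mathbf g_d$: for $d\in\mathbb N$, $\lambda_0,\ldots,\lambda_d\in\mathbb R\setminus\{0\}$ such that either (A) all $\lambda_0,\ldots,\lambda_d$ are positive, or (B) exactly one of them is negative, all others are positive and $\lambda_0+\cdots+\lambda_d<0$, and for $\varepsilon_1,\ldots,\varepsilon_d\in\{\pm1\}$, define $\mathbf g_d(\lambda_0;\lambda_1,\ldots,\lambda_d;\varepsilon_1,\ldots,\varepsilon_d):=\mathbb P[\varepsilon_1\eta_1\le0,\ldots,\varepsilon_d\eta_d\le0]$, where $(\eta_1,\ldots,\eta_d)$ is a centered Gaussian vector with covariance matrix $\bigl(\frac1{\lambda_0}+\frac{\delta_{ij}}{\lambda_i}\bigr)_{i,j=1}^d$. For $d=0$, $\mathbf g_0(\lambda_0):=1$ for all $\lambda_0\in\mathbb R$. *)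

theory Defs
  imports "HOL-Probability.Probability" "HOL-Complex_Analysis.Complex_Analysis"
begin

text \<open>The integrand is entire, so the straight segment from \<open>0\<close> to \<open>z\<close> stands for any contour.\<close>

definition Phi :: "complex \<Rightarrow> complex" where
  "Phi z = 1 / 2 + 1 / complex_of_real (sqrt (2 * pi)) *
     contour_integral (linepath 0 z) (\<lambda>x. exp (- (x ^ 2) / 2))"

text \<open>Constants count as (degenerate) Gaussian variables; this is needed below, since a
  linear combination of the components may vanish identically.\<close>

definition gaussian_rv :: "'a measure \<Rightarrow> ('a \<Rightarrow> real) \<Rightarrow> bool" where
  "gaussian_rv M X \<longleftrightarrow> X \<in> borel_measurable M \<and>
     ((\<exists>\<mu> \<sigma>. \<sigma> > 0 \<and> distributed M lborel X (normal_density \<mu> \<sigma>)) \<or>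
      (\<exists>c. AE \<omega> in M. X \<omega> = c))"

definition centered_gaussian_vector ::
    "'a measure \<Rightarrow> nat set \<Rightarrow> (nat \<Rightarrow> 'a \<Rightarrow> real) \<Rightarrow> (nat \<Rightarrow> nat \<Rightarrow> real) \<Rightarrow> bool" where
  "centered_gaussian_vector M I \<eta> C \<longleftrightarrow> prob_space M \<and>
     (\<forall>i\<in>I. \<eta> i \<in> borel_measurable M) \<and>
     (\<forall>a. gaussian_rv M (\<lambda>\<omega>. \<Sum>i\<in>I. a i * \<eta> i \<omega>)) \<and>
     (\<forall>i\<in>I. (\<integral>\<omega>. \<eta> i \<omega> \<partial>M) = 0) \<and>
     (\<forall>i\<in>I. \<forall>j\<in>I. (\<integral>\<omega>. \<eta> i \<omega> * \<eta> j \<omega> \<partial>M) = C i j)"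

definition g_cov :: "(nat \<Rightarrow> real) \<Rightarrow> nat \<Rightarrow> nat \<Rightarrow> real" where
  "g_cov l i j = 1 / l 0 + (if i = j then 1 / l i else 0)"

text \<open>\<open>g_fun d l \<epsilon>\<close> is meant for parameters \<open>l 0, \<dots>, l d\<close> that are either all positive, or of
  which exactly one is negative, the others being positive, with negative total sum; then
  \<open>g_cov l\<close> is positive definite on \<open>{1..d}\<close>.
  The probability depends only on the law of the vector, that is, on the covariance matrix, and
  every law on \<open>d\<close>-dimensional space is realised on a probability space whose points are functions
  \<open>nat \<Rightarrow> real\<close>, so a unique \<open>p\<close> as below exists.\<close>

definition g_fun :: "nat \<Rightarrow> (nat \<Rightarrow> real) \<Rightarrow> (nat \<Rightarrow> real) \<Rightarrow> real" where
  "g_fun d l \<epsilon> = (if d = 0 then 1 else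
     (THE p. \<exists>(M :: (nat \<Rightarrow> real) measure) \<eta>.
        centered_gaussian_vector M {1..d} \<eta> (g_cov l) \<and>
        p = \<P>(\<omega> in M. \<forall>j\<in>{1..d}. \<epsilon> j * \<eta> j \<omega> \<le> 0)))"

text \<open>For real \<open>a < 0\<close> the principal branch \<open>csqrt\<close> has the value \<open>\<i> * sqrt (- a)\<close>, which is
  the convention required for the square root of a negative \<open>l 0\<close>.\<close>

definition sqrt_quot :: "real \<Rightarrow> real \<Rightarrow> complex" where
  "sqrt_quot b a = csqrt (complex_of_real b) / csqrt (complex_of_real a)"

end

theory Submission
  imports Defs "HOL-Real_Asymp.Real_Asymp"
begin

text \<open>A centered Gaussian vector is determined by its characteristic function, so it suffices to find
  one convenient vector with the characteristic function belonging to \<open>g_cov l\<close>.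
  Let \<open>c\<close> be the parameter that may be an outlier (\<open>l 0\<close> in (i), \<open>l k\<close> in (ii)). Relative to
  independent standard normal variables \<open>\<xi> j\<close>, give the sample space the density proportional to
  \<open>exp ((\<Sum>j. sqrt (l j) * \<xi> j)\<^sup>2 / (2 * s))\<close>, where \<open>s\<close> is the sum of all parameters. Its square is
  linearised by one more standard normal variable \<open>x\<close>, with a real or imaginary coefficient
  \<open>\<theta>\<close> such that \<open>\<theta>\<^sup>2 = 1 / c\<close>. Given \<open>x\<close> the integrand factorises over \<open>j\<close>, and a half-line
  contributes the factor \<open>Phi\<close> at a possibly complex argument; this is (i).
  In (ii) one conditions moreover on the coordinate \<open>0\<close>, which leaves the mean over \<open>z\<close> of the
  integral of an entire function \<open>h\<close> along the ray \<open>\<i> z + [0, \<infinity>)\<close>. Shifting this ray to the real axis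
  yields the two integrals in (ii).\<close>

section \<open>Characteristic functions of Gaussian vectors\<close>

text \<open>For \<open>c > 0\<close> the wanted vector is \<open>u j + x / sqrt c\<close>, with
  independent \<open>u j\<close> of variance \<open>1 / lam j\<close> and one shared standard normal
  \<open>x\<close>. For \<open>c < 0\<close> the shared part would have to be imaginary, and no
  random variable provides that. Hence the law itself is kept real, as an explicit density on
  independent coordinates, and only its representation as an average over \<open>x\<close> becomes
  complex. Both sign conditions amount to \<open>s / c > 0\<close>, which makes the density
  normalisable; for negative \<open>c\<close> the same inequality gives the absolute convergence
  that Fubini needs for oscillating tilts. In (ii) the negative parameter sits on the diagonal,
  where \<open>1 / l k\<close> cannot be the variance of an independent part. Making
  \<open>l k\<close> central restores positive diagonal parameters, at the price of comparing all
  coordinates with one of them, so that the half-line thresholds become random. As a probability is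
  real, only the real part of the ray integral matters, and the vertical side of the contour enters
  as an imaginary part.\<close>

lemma cis_measurable [measurable]: "cis \<in> borel_measurable borel"
  by (intro borel_measurable_continuous_onI continuous_intros)

section \<open>Uniqueness of joint laws\<close>

text \<open>Levy uniqueness concerns probability measures, so the weights become densities
  \<open>v / m\<close> and \<open>w / m\<close>; the case \<open>t = 0\<close> shows that the total
  masses agree, and a zero mass forces both weights to vanish almost everywhere. In the application
  the weights carry the information on the other coordinates.\<close>

lemma weighted_char_determines:
  fixes X :: "'a \<Rightarrow> real" and Y :: "'b \<Rightarrow> real"
  assumes M: "finite_measure M" and N: "finite_measure N"
    and X [measurable]: "X \<in> borel_measurable M" and Y [measurable]: "Y \<in> borel_measurable N"
    and v: "integrable M v" "\<And>x. 0 \<le> v x"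
    and w: "integrable N w" "\<And>y. 0 \<le> w y"
    and eq: "\<And>t. (CLINT x|M. complex_of_real (v x) * cis (t * X x))
                 = (CLINT y|N. complex_of_real (w y) * cis (t * Y y))"
    and B [measurable]: "B \<in> sets borel"
  shows "(\<integral>x. v x * indicator B (X x) \<partial>M) = (\<integral>y. w y * indicator B (Y y) \<partial>N)"
proof -
  have vm [measurable]: "v \<in> borel_measurable M" and wm [measurable]: "w \<in> borel_measurable N"
    using v w by auto
  define m where "m = (\<integral>x. v x \<partial>M)"
  have "complex_of_real m = complex_of_real (\<integral>y. w y \<partial>N)"
    using eq[of 0] by (simp add: m_def)
  hence m': "m = (\<integral>y. w y \<partial>N)"
    by (simp only: of_real_eq_iff)
  have "m \<ge> 0" unfolding m_def using v by (intro Bochner_Integration.integral_nonneg) auto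
  show ?thesis
  proof (cases "m = 0")
    case True
    have "AE x in M. v x = 0"
      using integral_nonneg_eq_0_iff_AE[OF v(1)] v(2) True by (auto simp: m_def)
    moreover have "AE x in N. w x = 0"
      using integral_nonneg_eq_0_iff_AE[OF w(1)] w(2) True by (auto simp: m')
    ultimately show ?thesis
      by (subst (1 2) integral_eq_zero_AE) auto
  next
    case False
    hence mpos: "m > 0" using \<open>m \<ge> 0\<close> by simp
    \<comment> \<open>Proved once for a measure over its own type variable, because the two sides
      live on different sample spaces.\<close>
    have main: "real_distribution (distr (density L (\<lambda>x. u x / m)) borel Z) \<and>
       (\<forall>t. char (distr (density L (\<lambda>x. u x / m)) borel Z) t = (CLINT x|L. complex_of_real (u x) * cis (t * Z x)) / m) \<and>
       measure (distr (density L (\<lambda>x. u x / m)) borel Z) B = (\<integral>x. u x * indicator B (Z x) \<partial>L) / m"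
      if [measurable]: "Z \<in> borel_measurable L" "u \<in> borel_measurable L"
        and u: "integrable L u" "\<And>x. 0 \<le> u x" "m = (\<integral>x. u x \<partial>L)"
      for L :: "'c measure" and Z u
    proof (intro conjI allI)
      let ?D = "density L (\<lambda>x. u x / m)"
      have P: "prob_space ?D"
      proof
        have "emeasure ?D (space ?D) = (\<integral>\<^sup>+ x. ennreal (u x / m) \<partial>L)"
          by (subst emeasure_density) (auto intro!: nn_integral_cong)
        also have "\<dots> = ennreal (\<integral>x. u x / m \<partial>L)"
          using u mpos by (intro nn_integral_eq_integral) auto
        also have "\<dots> = 1" using u(3) mpos by simp
        finally show "emeasure ?D (space ?D) = 1" .
      qed
      then interpret D: prob_space ?D .
      show "real_distribution (distr ?D borel Z)"
        by (intro D.real_distribution_distr) simp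
      show "char (distr ?D borel Z) t = (CLINT x|L. complex_of_real (u x) * cis (t * Z x)) / m" for t
      proof -
        have "char (distr ?D borel Z) t = (CLINT x|L. (u x / m) *\<^sub>R iexp (t * Z x))"
        proof -
          have "char (distr ?D borel Z) t = (CLINT x|?D. iexp (t * Z x))"
            unfolding char_def by (rule integral_distr) measurable
          also have "\<dots> = (CLINT x|L. (u x / m) *\<^sub>R iexp (t * Z x))"
          proof (rule integral_density)
            show "AE x in L. 0 \<le> u x / m" using u mpos by simp
          qed measurable
          finally show ?thesis .
        qed
        also have "\<dots> = (CLINT x|L. complex_of_real (u x) * cis (t * Z x) / m)"
          by (intro Bochner_Integration.integral_cong refl)
            (simp only: cis_conv_exp scaleR_conv_of_real of_real_divide times_divide_eq_left)
        finally show ?thesis by (simp only: integral_divide_zero)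
      qed
      have "measure (distr ?D borel Z) B = (\<integral>x. indicator B (Z x) \<partial>?D)"
      proof -
        have "measure (distr ?D borel Z) B = (\<integral>x. indicator B x \<partial>distr ?D borel Z)"
          by simp
        also have "\<dots> = (\<integral>x. indicator B (Z x) \<partial>?D)"
          by (subst integral_distr) auto
        finally show ?thesis .
      qed
      also have "\<dots> = (\<integral>x. u x * indicator B (Z x) \<partial>L) / m"
        using u mpos by (subst integral_density) auto
      finally show "measure (distr ?D borel Z) B = (\<integral>x. u x * indicator B (Z x) \<partial>L) / m" .
    qed
    note a = main[OF X vm v m_def] and b = main[OF Y wm w m']
    have "distr (density M (\<lambda>x. v x / m)) borel X = distr (density N (\<lambda>x. w x / m)) borel Y"
      using a b eq by (intro Levy_uniqueness) auto
    hence "(\<integral>x. v x * indicator B (X x) \<partial>M) / m = (\<integral>y. w y * indicator B (Y y) \<partial>N) / m"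
      using a b by metis
    thus ?thesis using mpos by simp
  qed
qed

lemma integrable_bounded_finite:
  fixes f :: "'a \<Rightarrow> 'b :: {banach, second_countable_topology}"
  assumes "finite_measure M" "f \<in> borel_measurable M" "\<And>x. norm (f x) \<le> B"
  shows "integrable M f"
  using assms by (intro finite_measure.integrable_const_bound[where B = B]) auto

text \<open>One coordinate at a time, a character is replaced by an indicator. The one-dimensional
  uniqueness theorem is about nonnegative weights, so it is applied with \<open>1 + cos\<close> in place of
  the remaining characters.\<close>

lemma char_determines_partial:
  fixes X :: "'i \<Rightarrow> 'a \<Rightarrow> real" and Y :: "'i \<Rightarrow> 'b \<Rightarrow> real"
  assumes M: "prob_space M" and N: "prob_space N"
    and X: "\<And>i. i \<in> I \<Longrightarrow> X i \<in> borel_measurable M"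
    and Y: "\<And>i. i \<in> I \<Longrightarrow> Y i \<in> borel_measurable N"
    and fin: "finite I"
    and eq: "\<And>a. (CLINT x|M. cis (\<Sum>i\<in>I. a i * X i x)) = (CLINT y|N. cis (\<Sum>i\<in>I. a i * Y i y))"
    and B: "\<And>i. i \<in> I \<Longrightarrow> B i \<in> sets borel"
    and S: "S \<union> T = I" "S \<inter> T = {}"
  shows "(CLINT x|M. complex_of_real (\<Prod>i\<in>S. indicator (B i) (X i x)) * cis (\<Sum>i\<in>T. a i * X i x))
       = (CLINT y|N. complex_of_real (\<Prod>i\<in>S. indicator (B i) (Y i y)) * cis (\<Sum>i\<in>T. a i * Y i y))"
proof -
  have "finite S" using S fin by auto
  thus ?thesis using S
  proof (induction S arbitrary: T a)
    case empty
    thus ?case using eq by simp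
  next
    case (insert k S)
    interpret M: prob_space M by fact
    interpret N: prob_space N by fact
    have k: "k \<in> I" "k \<notin> T" "T \<subseteq> I" "S \<subseteq> I" using insert by auto
    have fT: "finite T" using fin k finite_subset by blast
    define V where "V x = (\<Prod>i\<in>S. indicator (B i) (X i x) :: real)" for x
    define V' where "V' x = (\<Prod>i\<in>S. indicator (B i) (Y i x) :: real)" for x
    define U where "U b x = (\<Sum>i\<in>T. b i * X i x)" for b x
    define U' where "U' b x = (\<Sum>i\<in>T. b i * Y i x)" for b x
    have V01: "0 \<le> V x" "V x \<le> 1" for x
      by (auto simp: V_def intro!: prod_nonneg prod_le_1)
    have V01': "0 \<le> V' x" "V' x \<le> 1" for x
      by (auto simp: V'_def intro!: prod_nonneg prod_le_1)
    have [measurable]: "V \<in> borel_measurable M" "V' \<in> borel_measurable N"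
      unfolding V_def[abs_def] V'_def[abs_def] using k X Y B
      by (auto intro!: borel_measurable_prod measurable_compose[OF X] measurable_compose[OF Y] borel_measurable_indicator)
    have [measurable]: "U b \<in> borel_measurable M" "U' b \<in> borel_measurable N" for b
      unfolding U_def[abs_def] U'_def[abs_def] using k X Y by (auto intro!: borel_measurable_sum borel_measurable_times)
    have [measurable]: "X k \<in> borel_measurable M" "Y k \<in> borel_measurable N" using k X Y by auto
    have [measurable]: "B k \<in> sets borel" using k B by auto
    have nv: "norm (complex_of_real (V x) * cis y) \<le> 1" "norm (complex_of_real (V' x') * cis y) \<le> 1" for x y x'
      using V01[of x] V01'[of x'] by (auto simp: norm_mult)
    \<comment> \<open>With frequency \<open>s\<close> at \<open>k\<close> this coordinate counts
      among the characters, so the induction hypothesis for \<open>S\<close> and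
      \<open>insert k T\<close> applies.\<close>
    have E: "(CLINT x|M. V x * cis (s * X k x + U b x)) = (CLINT x|N. V' x * cis (s * Y k x + U' b x))" for s b
    proof -
      have "(CLINT x|M. complex_of_real (\<Prod>i\<in>S. indicator (B i) (X i x)) * cis (\<Sum>i\<in>insert k T. (b(k := s)) i * X i x))
       = (CLINT y|N. complex_of_real (\<Prod>i\<in>S. indicator (B i) (Y i y)) * cis (\<Sum>i\<in>insert k T. (b(k := s)) i * Y i y))"
        using insert by (intro insert.IH) auto
      moreover have "(\<Sum>i\<in>insert k T. (b(k := s)) i * X i x) = s * X k x + U b x" for x
        using fT k unfolding U_def by (subst sum.insert) (auto intro!: sum.cong)
      moreover have "(\<Sum>i\<in>insert k T. (b(k := s)) i * Y i x) = s * Y k x + U' b x" for x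
        using fT k unfolding U'_def by (subst sum.insert) (auto intro!: sum.cong)
      ultimately show ?thesis unfolding V_def V'_def by (simp only:)
    qed
    have i0: "(\<integral>x. V x * indicator (B k) (X k x) \<partial>M) = (\<integral>x. V' x * indicator (B k) (Y k x) \<partial>N)"
    proof (rule weighted_char_determines)
      show "integrable M V" "integrable N V'"
        using V01 V01' by (auto intro!: integrable_bounded_finite[where B = 1] M.finite_measure_axioms N.finite_measure_axioms)
      show "(CLINT x|M. V x * cis (t * X k x)) = (CLINT x|N. V' x * cis (t * Y k x))" for t
        using E[of t "\<lambda>_. 0"] by (simp add: U_def U'_def)
    qed (use V01 V01' in \<open>auto intro: M.finite_measure_axioms N.finite_measure_axioms\<close>)
    have cos2: "\<bar>1 + cos y\<bar> \<le> 2" for y :: real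
      using abs_cos_le_one[of y] by linarith
    \<comment> \<open>The phase \<open>f\<close> stays free: \<open>f = 0\<close> and
      \<open>f = - pi / 2\<close> will give the real and the imaginary part of the remaining
      character.\<close>
    have i1: "(\<integral>x. V x * (1 + cos (U a x + f)) * indicator (B k) (X k x) \<partial>M)
        = (\<integral>x. V' x * (1 + cos (U' a x + f)) * indicator (B k) (Y k x) \<partial>N)" for f
    proof (rule weighted_char_determines)
      have "norm (V x * (1 + cos y)) \<le> 2" for x y
        using mult_mono[of "V x" 1 "\<bar>1 + cos y\<bar>" 2] V01[of x] cos2[of y]
        by (simp add: abs_mult)
      thus "integrable M (\<lambda>x. V x * (1 + cos (U a x + f)))"
        by (intro integrable_bounded_finite[where B = 2] M.finite_measure_axioms) auto
      have "norm (V' x * (1 + cos y)) \<le> 2" for x y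
        using mult_mono[of "V' x" 1 "\<bar>1 + cos y\<bar>" 2] V01'[of x] cos2[of y]
        by (simp add: abs_mult)
      thus "integrable N (\<lambda>x. V' x * (1 + cos (U' a x + f)))"
        by (intro integrable_bounded_finite[where B = 2] N.finite_measure_axioms) auto
      fix t
      \<comment> \<open>Euler's formula leaves only characters whose frequencies on \<open>T\<close>
        are \<open>0\<close>, \<open>a\<close> and \<open>- a\<close>, and \<open>E\<close> covers
        all three.\<close>
      have dec: "complex_of_real (v * (1 + cos (u + f))) * cis s = v * cis s + (cis f / 2 * (v * cis (s + u)) + cis (-f) / 2 * (v * cis (s - u)))" for v u s
        by (simp add: complex_eq_iff cos_add sin_add cos_diff sin_diff) (simp add: field_simps)
      have m1: "integrable M (\<lambda>x. V x * cis (t * X k x))" "integrable M (\<lambda>x. V x * cis (t * X k x + U a x))"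
           "integrable M (\<lambda>x. V x * cis (t * X k x - U a x))"
           "integrable N (\<lambda>x. V' x * cis (t * Y k x))" "integrable N (\<lambda>x. V' x * cis (t * Y k x + U' a x))"
           "integrable N (\<lambda>x. V' x * cis (t * Y k x - U' a x))"
        by (intro integrable_bounded_finite[where B = 1] M.finite_measure_axioms N.finite_measure_axioms nv; measurable)+
      have neg: "U (\<lambda>i. - a i) x = - U a x" "U' (\<lambda>i. - a i) y = - U' a y" for x y
        by (auto simp: U_def U'_def sum_negf)
      show "(CLINT x|M. complex_of_real (V x * (1 + cos (U a x + f))) * cis (t * X k x))
          = (CLINT x|N. complex_of_real (V' x * (1 + cos (U' a x + f))) * cis (t * Y k x))"
        unfolding dec
        using m1 E[of t "\<lambda>_. 0"] E[of t a] E[of t "\<lambda>i. - a i"]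
        by (simp add: neg) (simp add: U_def U'_def)
      show "0 \<le> V x * (1 + cos (U a x + f))" for x
        using V01[of x] cos_ge_minus_one[of "U a x + f"] by (intro mult_nonneg_nonneg) linarith+
      show "0 \<le> V' x * (1 + cos (U' a x + f))" for x
        using V01'[of x] cos_ge_minus_one[of "U' a x + f"] by (intro mult_nonneg_nonneg) linarith+
    qed (auto intro: M.finite_measure_axioms N.finite_measure_axioms)
    have b2: "norm (V x * cos y * indicator A z) \<le> 1" "norm (V' x' * cos y * indicator A z) \<le> 1" for x x' y and A :: "real set" and z
      using mult_mono[of "V x" 1 "\<bar>cos y\<bar>" 1] V01[of x] mult_mono[of "V' x'" 1 "\<bar>cos y\<bar>" 1] V01'[of x'] abs_cos_le_one[of y]
      by (auto simp: abs_mult indicator_def)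
    have b3: "norm (V x * indicator A z) \<le> 1" "norm (V' x' * indicator A z) \<le> 1" for x x' and A :: "real set" and z
      using V01[of x] V01'[of x'] by (auto simp: indicator_def)
    \<comment> \<open>The constant \<open>1\<close>, added to make the weight nonnegative, is
      removed again by means of \<open>i0\<close>.\<close>
    have i2: "(\<integral>x. V x * cos (U a x + f) * indicator (B k) (X k x) \<partial>M)
        = (\<integral>x. V' x * cos (U' a x + f) * indicator (B k) (Y k x) \<partial>N)" for f
    proof -
      have m1: "integrable M (\<lambda>x. V x * indicator (B k) (X k x))" "integrable M (\<lambda>x. V x * cos (U a x + f) * indicator (B k) (X k x))"
          "integrable N (\<lambda>x. V' x * indicator (B k) (Y k x))" "integrable N (\<lambda>x. V' x * cos (U' a x + f) * indicator (B k) (Y k x))"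
        by (intro integrable_bounded_finite[where B = 1] M.finite_measure_axioms N.finite_measure_axioms b2 b3; measurable)+
      show ?thesis using i1[of f] i0 m1 by (simp add: distrib_left distrib_right)
    qed
    have m2: "integrable M (\<lambda>x. V x * cos (U a x + f) * indicator (B k) (X k x))"
          "integrable N (\<lambda>x. V' x * cos (U' a x + f) * indicator (B k) (Y k x))" for f
        by (intro integrable_bounded_finite[where B = 1] M.finite_measure_axioms N.finite_measure_axioms b2 b3; measurable)+
    have dec: "complex_of_real (\<Prod>i\<in>insert k S. indicator (B i) (X i x)) * cis (\<Sum>i\<in>T. a i * X i x)
       = complex_of_real (V x * cos (U a x + 0) * indicator (B k) (X k x)) + \<i> * complex_of_real (V x * cos (U a x + (-pi/2)) * indicator (B k) (X k x))" for x
      using insert.hyps by (simp add: V_def U_def complex_eq_iff cos_diff flip: of_real_prod of_real_mult)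
    have dec': "complex_of_real (\<Prod>i\<in>insert k S. indicator (B i) (Y i x)) * cis (\<Sum>i\<in>T. a i * Y i x)
       = complex_of_real (V' x * cos (U' a x + 0) * indicator (B k) (Y k x)) + \<i> * complex_of_real (V' x * cos (U' a x + (-pi/2)) * indicator (B k) (Y k x))" for x
      using insert.hyps by (simp add: V'_def U'_def complex_eq_iff cos_diff flip: of_real_prod of_real_mult)
    show ?case
      unfolding dec dec'
      by (subst (1 2) Bochner_Integration.integral_add)
         (use i2 m2[of 0] m2[of "-pi/2"] i2[of 0] i2[of "-pi/2"] in
           \<open>auto intro!: integrable_mult_right integrable_of_real simp del: of_real_mult\<close>)
  qed
qed


lemma char_determines_box:
  fixes X :: "'i \<Rightarrow> 'a \<Rightarrow> real" and Y :: "'i \<Rightarrow> 'b \<Rightarrow> real"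
  assumes M: "prob_space M" and N: "prob_space N"
    and X: "\<And>i. i \<in> I \<Longrightarrow> X i \<in> borel_measurable M"
    and Y: "\<And>i. i \<in> I \<Longrightarrow> Y i \<in> borel_measurable N"
    and fin: "finite I"
    and eq: "\<And>a. (CLINT x|M. cis (\<Sum>i\<in>I. a i * X i x)) = (CLINT y|N. cis (\<Sum>i\<in>I. a i * Y i y))"
    and B: "\<And>i. i \<in> I \<Longrightarrow> B i \<in> sets borel"
  shows "\<P>(x in M. \<forall>i\<in>I. X i x \<in> B i) = \<P>(y in N. \<forall>i\<in>I. Y i y \<in> B i)"
proof -
  have *: "(CLINT x|L. complex_of_real (\<Prod>i\<in>I. indicator (B i) (Z i x))) = complex_of_real (\<P>(x in L. \<forall>i\<in>I. Z i x \<in> B i))"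
    for L :: "'c measure" and Z
  proof -
    have "(\<Prod>i\<in>I. indicator (B i) (Z i x)) = (if \<forall>i\<in>I. Z i x \<in> B i then 1 else 0 :: real)" for x
      using fin by (auto simp: indicator_def)
    hence "(CLINT x|L. complex_of_real (\<Prod>i\<in>I. indicator (B i) (Z i x)))
        = (CLINT x|L. complex_of_real (indicator {x\<in>space L. \<forall>i\<in>I. Z i x \<in> B i} x))"
      by (intro Bochner_Integration.integral_cong) (auto simp: indicator_def)
    also have "\<dots> = complex_of_real (\<integral>x. indicator {x\<in>space L. \<forall>i\<in>I. Z i x \<in> B i} x \<partial>L)"
      by (rule integral_complex_of_real)
    also have "\<dots> = complex_of_real (\<P>(x in L. \<forall>i\<in>I. Z i x \<in> B i))"
      by (simp add: Int_absorb2 subset_eq)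
    finally show ?thesis .
  qed
  have "(CLINT x|M. complex_of_real (\<Prod>i\<in>I. indicator (B i) (X i x))) = (CLINT x|N. complex_of_real (\<Prod>i\<in>I. indicator (B i) (Y i x)))"
    using char_determines_partial[OF M N X Y fin eq B, where S = I and T = "{}"] by simp
  thus ?thesis unfolding * by simp
qed

section \<open>Passage between second moments and characteristic functions\<close>

lemma char_std_normal_cis: "(CLINT x|std_normal_distribution. cis (t * x)) = exp (- (t\<^sup>2) / 2)"
  using fun_cong[OF char_std_normal_distribution, of t] by (simp add: char_def cis_conv_exp)

lemma prob_std_normal: "prob_space std_normal_distribution"
  by (rule prob_space_normal_density) simp

text \<open>\<open>gaussian_rv\<close> says nothing about integrability; both of its alternatives
  provide it. A vanishing mean forces \<open>\<mu> = 0\<close> or \<open>c = 0\<close>, after which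
  the second moment determines the law.\<close>

lemma gaussian_rv_moments:
  assumes "prob_space M" "gaussian_rv M X" "(\<integral>x. X x \<partial>M) = 0"
  shows "integrable M X" "integrable M (\<lambda>x. (X x)\<^sup>2)"
    "(CLINT x|M. cis (X x)) = exp (- (\<integral>x. (X x)\<^sup>2 \<partial>M) / 2)"
proof -
  interpret prob_space M by fact
  have X [measurable]: "X \<in> borel_measurable M" using assms by (simp add: gaussian_rv_def)
  from assms(2) consider (n) \<mu> \<sigma> where "\<sigma> > 0" "distributed M lborel X (normal_density \<mu> \<sigma>)"
    | (c) c where "AE x in M. X x = c"
    by (auto simp: gaussian_rv_def)
  hence "integrable M X \<and> integrable M (\<lambda>x. (X x)\<^sup>2) \<and>
    (CLINT x|M. cis (X x)) = exp (- (\<integral>x. (X x)\<^sup>2 \<partial>M) / 2)"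
  proof cases
    case n
    have "\<mu> = 0" using normal_distributed_expectation[OF n] assms(3) by simp
    note n = n[unfolded this]
    have v: "(\<integral>x. (X x)\<^sup>2 \<partial>M) = \<sigma>\<^sup>2"
      using normal_distributed_variance[OF n] assms(3) by simp
    have i: "integrable M X"
      using integrable_normal_moment_nz_1[OF n(1), of 0]
      by (subst distributed_integrable[OF n(2), of "\<lambda>x. x", symmetric]) auto
    have i2: "integrable M (\<lambda>x. (X x)\<^sup>2)"
      using integrable_normal_moment[OF n(1), of 0 2]
      by (subst distributed_integrable[OF n(2), of "\<lambda>x. x\<^sup>2", symmetric]) auto
    have "distributed M lborel (\<lambda>x. X x / \<sigma>) std_normal_density"
      using n normal_standard_normal_convert[OF n(1), of X 0] by simp
    hence d: "distr M lborel (\<lambda>x. X x / \<sigma>) = std_normal_distribution"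
      by (simp add: distributed_def)
    have "(CLINT x|M. cis (X x)) = (CLINT x|M. cis (\<sigma> * (X x / \<sigma>)))"
      using n(1) by simp
    also have "\<dots> = (CLINT y|distr M lborel (\<lambda>x. X x / \<sigma>). cis (\<sigma> * y))"
      by (subst integral_distr) auto
    also have "\<dots> = exp (- (\<sigma>\<^sup>2) / 2)"
      unfolding d by (rule char_std_normal_cis)
    finally show ?thesis using i i2 v by simp
  next
    case c
    have "(\<integral>x. X x \<partial>M) = (\<integral>x. c \<partial>M)"
      using c by (intro integral_cong_AE) auto
    hence "c = 0" using assms(3) by (simp add: prob_space)
    hence c: "AE x in M. X x = 0" using c by simp
    have "integrable M X \<longleftrightarrow> integrable M (\<lambda>x. 0 :: real)"
      using c by (intro integrable_cong_AE) auto
    moreover have "integrable M (\<lambda>x. (X x)\<^sup>2) \<longleftrightarrow> integrable M (\<lambda>x. 0 :: real)"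
      using c by (intro integrable_cong_AE) auto
    moreover have "(\<integral>x. (X x)\<^sup>2 \<partial>M) = (\<integral>x. 0 \<partial>M)"
      using c by (intro integral_cong_AE) auto
    moreover have "(CLINT x|M. cis (X x)) = (CLINT x|M. 1)"
      using c by (intro integral_cong_AE) auto
    ultimately show ?thesis by (simp add: prob_space)
  qed
  thus "integrable M X" "integrable M (\<lambda>x. (X x)\<^sup>2)"
    "(CLINT x|M. cis (X x)) = exp (- (\<integral>x. (X x)\<^sup>2 \<partial>M) / 2)" by auto
qed

lemma sum_unit_vector:
  fixes f :: "'i \<Rightarrow> 'a :: semiring_1"
  assumes "finite I" "i \<in> I"
  shows "(\<Sum>k\<in>I. (if k = i then 1 else 0) * f k) = f i"
proof -
  have "(\<Sum>k\<in>I. (if k = i then 1 else 0) * f k) = (\<Sum>k\<in>I. if k = i then f k else 0)"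
    by (intro sum.cong) auto
  thus ?thesis using assms by simp
qed

text \<open>A linear combination is a centered Gaussian variable, and its second moment is the
  quadratic form of \<open>C\<close>. Unit coefficient vectors yield square integrability of each
  component, so that the square of the sum can be integrated term by term.\<close>

lemma centered_gaussian_vector_char:
  assumes G: "centered_gaussian_vector M I \<eta> C" and fin: "finite I"
  shows "(CLINT x|M. cis (\<Sum>i\<in>I. a i * \<eta> i x)) = exp (- (\<Sum>i\<in>I. \<Sum>j\<in>I. a i * a j * C i j) / 2)"
proof -
  have P: "prob_space M" using G by (simp add: centered_gaussian_vector_def)
  have [measurable]: "\<eta> i \<in> borel_measurable M" if "i \<in> I" for i
    using G that by (simp add: centered_gaussian_vector_def)
  have g: "gaussian_rv M (\<lambda>x. \<Sum>i\<in>I. b i * \<eta> i x)" for b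
    using G by (simp add: centered_gaussian_vector_def)
  have i: "integrable M (\<eta> i)" "integrable M (\<lambda>x. (\<eta> i x)\<^sup>2)" if "i \<in> I" for i
  proof -
    have "(\<Sum>j\<in>I. (if j = i then 1 else 0) * \<eta> j x) = \<eta> i x" for x
      using that fin by (intro sum_unit_vector)
    hence "gaussian_rv M (\<eta> i)" using g[of "\<lambda>j. if j = i then 1 else 0"] by simp
    moreover have "(\<integral>x. \<eta> i x \<partial>M) = 0" using G that by (simp add: centered_gaussian_vector_def)
    ultimately show "integrable M (\<eta> i)" "integrable M (\<lambda>x. (\<eta> i x)\<^sup>2)"
      using gaussian_rv_moments[OF P] by auto
  qed
  have i2: "integrable M (\<lambda>x. \<eta> i x * \<eta> j x)" if "i \<in> I" "j \<in> I" for i j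
  proof (rule Bochner_Integration.integrable_bound)
    show "integrable M (\<lambda>x. (\<eta> i x)\<^sup>2 + (\<eta> j x)\<^sup>2)" using i that by auto
    have "\<bar>u * v\<bar> \<le> u\<^sup>2 + v\<^sup>2" for u v :: real
    proof -
      have "2 * \<bar>u\<bar> * \<bar>v\<bar> \<le> u\<^sup>2 + v\<^sup>2" using sum_squares_bound[of "\<bar>u\<bar>" "\<bar>v\<bar>"] by simp
      moreover have "0 \<le> \<bar>u\<bar> * \<bar>v\<bar>" by simp
      ultimately show ?thesis unfolding abs_mult by linarith
    qed
    thus "AE x in M. norm (\<eta> i x * \<eta> j x) \<le> norm ((\<eta> i x)\<^sup>2 + (\<eta> j x)\<^sup>2)" by simp
  qed (use that in measurable)
  have e: "(\<integral>x. (\<Sum>i\<in>I. a i * \<eta> i x) \<partial>M) = 0"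
    using i G by (simp add: Bochner_Integration.integral_sum centered_gaussian_vector_def)
  have "(\<integral>x. (\<Sum>i\<in>I. a i * \<eta> i x)\<^sup>2 \<partial>M) = (\<integral>x. (\<Sum>i\<in>I. \<Sum>j\<in>I. (a i * a j) * (\<eta> i x * \<eta> j x)) \<partial>M)"
    by (simp add: power2_eq_square sum_product mult_ac)
  also have "\<dots> = (\<Sum>i\<in>I. \<Sum>j\<in>I. a i * a j * C i j)"
    using i2 G by (simp add: Bochner_Integration.integral_sum centered_gaussian_vector_def)
  finally show ?thesis using gaussian_rv_moments(3)[OF P g e] by simp
qed

text \<open>The characteristic function identifies the law with that of \<open>sqrt v\<close> times
  a standard normal variable, and all moments are transported from there. The case
  \<open>v = 0\<close> lands in the degenerate alternative of \<open>gaussian_rv\<close>.\<close>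

lemma gaussian_rv_of_char:
  assumes P: "prob_space M" and X [measurable]: "X \<in> borel_measurable M"
    and char: "\<And>t. (CLINT x|M. cis (t * X x)) = exp (- (t\<^sup>2 * v) / 2)"
  shows "gaussian_rv M X" "integrable M (\<lambda>x. (X x)\<^sup>2)" "integrable M X"
    "(\<integral>x. X x \<partial>M) = 0" "(\<integral>x. (X x)\<^sup>2 \<partial>M) = v"
proof -
  interpret prob_space M by fact
  interpret N: prob_space std_normal_distribution by (rule prob_std_normal)
  let ?N = std_normal_distribution
  \<comment> \<open>A characteristic function is bounded by one; at \<open>t = 1\<close> this forces
    \<open>v \<ge> 0\<close>.\<close>
  have "norm (CLINT x|M. cis (1 * X x)) \<le> (\<integral>x. norm (cis (1 * X x)) \<partial>M)"
    by (rule integral_norm_bound)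
  hence "norm (complex_of_real (exp (- v / 2))) \<le> 1"
    unfolding char by (simp add: prob_space)
  hence v: "v \<ge> 0" by (simp add: norm_exp_eq_Re del: of_real_exp)
  define \<sigma> where "\<sigma> = sqrt v"
  have \<sigma>: "\<sigma> \<ge> 0" "\<sigma>\<^sup>2 = v" using v by (auto simp: \<sigma>_def)
  have D: "distr M borel X = distr ?N borel (\<lambda>x. \<sigma> * x)"
  proof (rule Levy_uniqueness)
    show "real_distribution (distr M borel X)" by (intro real_distribution_distr) simp
    show "real_distribution (distr ?N borel (\<lambda>x. \<sigma> * x))" by (intro N.real_distribution_distr) simp
    have "char (distr M borel X) t = char (distr ?N borel (\<lambda>x. \<sigma> * x)) t" for t
    proof -
      have "char (distr M borel X) t = (CLINT x|M. cis (t * X x))"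
        unfolding char_def by (subst integral_distr) (auto simp: cis_conv_exp)
      also have "\<dots> = (CLINT x|?N. cis ((t * \<sigma>) * x))"
        unfolding char char_std_normal_cis by (simp add: power_mult_distrib \<sigma>)
      also have "\<dots> = char (distr ?N borel (\<lambda>x. \<sigma> * x)) t"
        unfolding char_def by (subst integral_distr) (auto simp: cis_conv_exp mult_ac)
      finally show ?thesis .
    qed
    thus "char (distr M borel X) = char (distr ?N borel (\<lambda>x. \<sigma> * x))" by auto
  qed
  have I: "integrable M (\<lambda>x. (X x) ^ k)" "(\<integral>x. (X x) ^ k \<partial>M) = \<sigma> ^ k * (\<integral>x. x ^ k \<partial>?N)" for k
  proof -
    have "integrable M (\<lambda>x. (X x) ^ k) \<longleftrightarrow> integrable (distr M borel X) (\<lambda>x. x ^ k)"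
      by (subst integrable_distr_eq) auto
    also have "\<dots> \<longleftrightarrow> integrable ?N (\<lambda>x. (\<sigma> * x) ^ k)"
      unfolding D by (subst integrable_distr_eq) auto
    also have \<dots>
      unfolding power_mult_distrib by (intro integrable_mult_right integrable_std_normal_distribution_moment)
    finally show "integrable M (\<lambda>x. (X x) ^ k)" .
    have "(\<integral>x. (X x) ^ k \<partial>M) = (\<integral>x. x ^ k \<partial>distr M borel X)"
      by (subst integral_distr) auto
    also have "\<dots> = (\<integral>x. (\<sigma> * x) ^ k \<partial>?N)"
      unfolding D by (subst integral_distr) auto
    finally show "(\<integral>x. (X x) ^ k \<partial>M) = \<sigma> ^ k * (\<integral>x. x ^ k \<partial>?N)"
      unfolding power_mult_distrib by simp
  qed
  show "integrable M (\<lambda>x. (X x)\<^sup>2)" "integrable M X"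
    using I(1)[of 2] I(1)[of 1] by auto
  show "(\<integral>x. X x \<partial>M) = 0"
    using I(2)[of 1] integral_std_normal_distribution_moment_odd[of 1] by simp
  show "(\<integral>x. (X x)\<^sup>2 \<partial>M) = v"
    using I(2)[of 2] std_normal_distribution_even_moments(1)[of 1] \<sigma> by (simp add: fact_numeral)
  show "gaussian_rv M X"
  proof (cases "\<sigma> = 0")
    case True
    have "(\<integral>x. (X x)\<^sup>2 \<partial>M) = 0" using I(2)[of 2] True by simp
    hence "AE x in M. (X x)\<^sup>2 = 0"
      using integral_nonneg_eq_0_iff_AE[OF I(1)[of 2]] by simp
    thus ?thesis unfolding gaussian_rv_def using X by auto
  next
    case False
    hence \<sigma>p: "\<sigma> > 0" using \<sigma> by simp
    have "distributed ?N lborel (\<lambda>x. x) std_normal_density"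
      by (simp add: distributed_def distr_id2)
    from N.normal_density_affine[OF this, of \<sigma> 0] \<sigma>p
    have "distr ?N lborel (\<lambda>x. \<sigma> * x) = density lborel (normal_density 0 \<sigma>)"
      by (simp add: distributed_def)
    moreover have "distr ?N lborel (\<lambda>x. \<sigma> * x) = distr ?N borel (\<lambda>x. \<sigma> * x)" by (rule distr_cong) auto
    moreover have "distr M lborel X = distr M borel X" by (rule distr_cong) auto
    ultimately have "distributed M lborel X (normal_density 0 \<sigma>)"
      using D by (simp add: distributed_def)
    thus ?thesis unfolding gaussian_rv_def using X \<sigma>p by blast
  qed
qed

text \<open>Replacing \<open>a\<close> by \<open>t * a\<close> turns the joint hypothesis into the
  characteristic function of each single linear combination, with the quadratic form as variance.
  Unit vectors and their pairwise sums then recover the covariances by polarisation, where symmetry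
  of \<open>C\<close> merges the two mixed entries.\<close>

lemma centered_gaussian_vectorI_char:
  assumes P: "prob_space M" and fin: "finite I"
    and m: "\<And>i. i \<in> I \<Longrightarrow> \<eta> i \<in> borel_measurable M"
    and sym: "\<And>i j. i \<in> I \<Longrightarrow> j \<in> I \<Longrightarrow> C i j = C j i"
    and char: "\<And>a. (CLINT x|M. cis (\<Sum>i\<in>I. a i * \<eta> i x)) = exp (- (\<Sum>i\<in>I. \<Sum>j\<in>I. a i * a j * C i j) / 2)"
  shows "centered_gaussian_vector M I \<eta> C"
proof -
  define Q where "Q a = (\<Sum>i\<in>I. \<Sum>j\<in>I. a i * a j * C i j)" for a
  define X where "X a x = (\<Sum>i\<in>I. a i * \<eta> i x)" for a x
  have X: "X a \<in> borel_measurable M" for a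
    unfolding X_def[abs_def] using m by (auto intro!: borel_measurable_sum borel_measurable_times)
  have "(CLINT x|M. cis (t * X a x)) = exp (- (t\<^sup>2 * Q a) / 2)" for a t
    using char[of "\<lambda>i. t * a i"]
    by (simp add: X_def Q_def sum_distrib_left power2_eq_square mult_ac)
  note g = gaussian_rv_of_char[OF P X this]
  define e where "e i = (\<lambda>k. if k = i then 1 else 0 :: real)" for i :: nat
  have Xe: "X (e i) x = \<eta> i x" if "i \<in> I" for i x
    using that fin by (simp add: X_def e_def sum_unit_vector)
  have Xe2: "X (\<lambda>k. e i k + e j k) x = \<eta> i x + \<eta> j x" if "i \<in> I" "j \<in> I" for i j x
    using that fin by (simp add: X_def e_def distrib_right sum.distrib sum_unit_vector)
  have Qe: "Q (e i) = C i i" if "i \<in> I" for i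
    using that fin by (simp add: Q_def e_def mult.assoc sum_unit_vector flip: sum_distrib_left)
  have Qe2: "Q (\<lambda>k. e i k + e j k) = C i i + C i j + C j i + C j j" if "i \<in> I" "j \<in> I" for i j
  proof -
    have "Q (\<lambda>k. e i k + e j k) = (\<Sum>k\<in>I. (e i k + e j k) * (\<Sum>l\<in>I. (e i l + e j l) * C k l))"
      by (simp add: Q_def sum_distrib_left mult_ac)
    also have "\<dots> = (\<Sum>k\<in>I. (e i k + e j k) * (C k i + C k j))"
      using that fin by (simp add: e_def distrib_right sum.distrib sum_unit_vector)
    also have "\<dots> = C i i + C i j + C j i + C j j"
      using that fin by (simp add: e_def distrib_right sum.distrib sum_unit_vector)
    finally show ?thesis .
  qed
  have cov: "(\<integral>x. \<eta> i x * \<eta> j x \<partial>M) = C i j" if ij: "i \<in> I" "j \<in> I" for i j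
  proof -
    have "(\<lambda>x. \<eta> i x * \<eta> j x) = (\<lambda>x. ((\<eta> i x + \<eta> j x)\<^sup>2 - (\<eta> i x)\<^sup>2 - (\<eta> j x)\<^sup>2) / 2)"
      by (simp add: power2_eq_square algebra_simps)
    hence "(\<integral>x. \<eta> i x * \<eta> j x \<partial>M) = (\<integral>x. ((\<eta> i x + \<eta> j x)\<^sup>2 - (\<eta> i x)\<^sup>2 - (\<eta> j x)\<^sup>2) / 2 \<partial>M)"
      by (rule arg_cong)
    moreover have "integrable M (\<lambda>x. (\<eta> i x)\<^sup>2)" "integrable M (\<lambda>x. (\<eta> j x)\<^sup>2)" "integrable M (\<lambda>x. (\<eta> i x + \<eta> j x)\<^sup>2)"
      using g(2)[of "e i"] g(2)[of "e j"] g(2)[of "\<lambda>k. e i k + e j k"] ij by (simp_all add: Xe Xe2)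
    moreover have "(\<integral>x. (\<eta> i x)\<^sup>2 \<partial>M) = C i i" "(\<integral>x. (\<eta> j x)\<^sup>2 \<partial>M) = C j j"
      "(\<integral>x. (\<eta> i x + \<eta> j x)\<^sup>2 \<partial>M) = C i i + C i j + C j i + C j j"
      using g(5)[of "e i"] g(5)[of "e j"] g(5)[of "\<lambda>k. e i k + e j k"] ij by (simp_all add: Xe Xe2 Qe Qe2)
    ultimately show ?thesis using sym[OF ij] by simp
  qed
  have "(\<integral>x. \<eta> i x \<partial>M) = 0" if "i \<in> I" for i
    using g(4)[of "e i"] that by (simp add: Xe)
  thus ?thesis unfolding centered_gaussian_vector_def
    using P m cov g(1)[unfolded X_def] by blast
qed

text \<open>The exponent is the quadratic form of \<open>g_cov l\<close>. So the given model
  witnesses the definite description, and any other model assigns the same probability to the box of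
  half-lines \<open>\<epsilon> i * y \<le> 0\<close>.\<close>

lemma g_fun_eqI:
  fixes M :: "(nat \<Rightarrow> real) measure"
  assumes "d > 0" and P: "prob_space M"
    and m: "\<And>i. i \<in> {1..d} \<Longrightarrow> \<eta> i \<in> borel_measurable M"
    and char: "\<And>a. (CLINT x|M. cis (\<Sum>i\<in>{1..d}. a i * \<eta> i x))
        = exp (- ((\<Sum>i\<in>{1..d}. a i)\<^sup>2 / l 0 + (\<Sum>i\<in>{1..d}. (a i)\<^sup>2 / l i)) / 2)"
  shows "g_fun d l \<epsilon> = \<P>(\<omega> in M. \<forall>j\<in>{1..d}. \<epsilon> j * \<eta> j \<omega> \<le> 0)"
proof -
  let ?I = "{1..d}"
  have q: "(\<Sum>i\<in>?I. \<Sum>j\<in>?I. a i * a j * g_cov l i j) = (\<Sum>i\<in>?I. a i)\<^sup>2 / l 0 + (\<Sum>i\<in>?I. (a i)\<^sup>2 / l i)" for a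
  proof -
    have "(\<Sum>i\<in>?I. \<Sum>j\<in>?I. a i * a j * g_cov l i j)
       = (\<Sum>i\<in>?I. \<Sum>j\<in>?I. a i * a j / l 0) + (\<Sum>i\<in>?I. \<Sum>j\<in>?I. if i = j then a i * a j / l i else 0)"
      unfolding sum.distrib[symmetric] by (intro sum.cong) (auto simp: g_cov_def distrib_left)
    thus ?thesis by (simp add: power2_eq_square sum_product sum_divide_distrib)
  qed
  have char': "(CLINT x|M. cis (\<Sum>i\<in>?I. a i * \<eta> i x)) = exp (- (\<Sum>i\<in>?I. \<Sum>j\<in>?I. a i * a j * g_cov l i j) / 2)" for a
    unfolding char q ..
  have G: "centered_gaussian_vector M ?I \<eta> (g_cov l)"
    using P m char' by (intro centered_gaussian_vectorI_char) (auto simp: g_cov_def)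
  have u: "p = \<P>(\<omega> in M. \<forall>j\<in>?I. \<epsilon> j * \<eta> j \<omega> \<le> 0)"
    if "\<exists>(M' :: (nat \<Rightarrow> real) measure) \<eta>'. centered_gaussian_vector M' ?I \<eta>' (g_cov l) \<and>
        p = \<P>(\<omega> in M'. \<forall>j\<in>?I. \<epsilon> j * \<eta>' j \<omega> \<le> 0)" for p
  proof -
    from that obtain M' :: "(nat \<Rightarrow> real) measure" and \<eta>' where G': "centered_gaussian_vector M' ?I \<eta>' (g_cov l)"
      and p: "p = \<P>(\<omega> in M'. \<forall>j\<in>?I. \<epsilon> j * \<eta>' j \<omega> \<le> 0)" by blast
    have "\<P>(x in M'. \<forall>i\<in>?I. \<eta>' i x \<in> {y. \<epsilon> i * y \<le> 0}) = \<P>(x in M. \<forall>i\<in>?I. \<eta> i x \<in> {y. \<epsilon> i * y \<le> 0})"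
    proof (rule char_determines_box)
      show "prob_space M'" "\<And>i. i \<in> ?I \<Longrightarrow> \<eta>' i \<in> borel_measurable M'"
        using G' by (auto simp: centered_gaussian_vector_def)
      show "(CLINT x|M'. cis (\<Sum>i\<in>?I. a i * \<eta>' i x)) = (CLINT x|M. cis (\<Sum>i\<in>?I. a i * \<eta> i x))" for a
        unfolding char' by (rule centered_gaussian_vector_char[OF G']) simp
      show "{y. \<epsilon> i * y \<le> 0} \<in> sets borel" for i
        by measurable
    qed (use P m in auto)
    thus ?thesis by (simp add: p)
  qed
  have "(THE p. \<exists>(M :: (nat \<Rightarrow> real) measure) \<eta>. centered_gaussian_vector M ?I \<eta> (g_cov l) \<and>
        p = \<P>(\<omega> in M. \<forall>j\<in>?I. \<epsilon> j * \<eta> j \<omega> \<le> 0)) = \<P>(\<omega> in M. \<forall>j\<in>?I. \<epsilon> j * \<eta> j \<omega> \<le> 0)"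
    using G u by (intro the_equality) blast+
  thus ?thesis using \<open>d > 0\<close> by (simp add: g_fun_def)
qed

section \<open>Exponential tilts of the normal distribution\<close>

text \<open>The path in the definition of \<open>Phi\<close> varies with \<open>z\<close>; a single
  primitive for all endpoints makes differentiation possible.\<close>

lemma Phi_primitive: "\<exists>P :: complex \<Rightarrow> complex. (\<forall>z. (P has_field_derivative exp (- (z\<^sup>2) / 2)) (at z)) \<and>
    (\<forall>z. Phi z = 1 / 2 + 1 / complex_of_real (sqrt (2 * pi)) * (P z - P 0))"
proof -
  have "(\<lambda>z :: complex. exp (- (z\<^sup>2) / 2)) holomorphic_on UNIV"
    by (intro holomorphic_intros) auto
  then obtain P :: "complex \<Rightarrow> complex" where P: "\<And>z. (P has_field_derivative exp (- (z\<^sup>2) / 2)) (at z)"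
    using holomorphic_convex_primitive'[of UNIV "\<lambda>z :: complex. exp (- (z\<^sup>2) / 2)"] by auto
  have "contour_integral (linepath 0 z) (\<lambda>x. exp (- (x ^ 2) / 2)) = P z - P 0" for z
  proof -
    have "((\<lambda>x. exp (- (x\<^sup>2) / 2)) has_contour_integral
        P (pathfinish (linepath 0 z)) - P (pathstart (linepath 0 z))) (linepath 0 z)"
      by (rule contour_integral_primitive[where S = UNIV]) (rule P valid_path_linepath subset_UNIV)+
    thus ?thesis
      unfolding pathfinish_linepath pathstart_linepath by (rule contour_integral_unique)
  qed
  hence "\<forall>z. Phi z = 1 / 2 + 1 / complex_of_real (sqrt (2 * pi)) * (P z - P 0)"
    unfolding Phi_def by (simp only: simp_thms)
  thus ?thesis using P by blast
qed

lemma Phi_has_field_derivative: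
  "(Phi has_field_derivative exp (- (z\<^sup>2) / 2) / complex_of_real (sqrt (2 * pi))) (at z)"
proof -
  obtain P where P: "\<And>z. (P has_field_derivative exp (- (z\<^sup>2) / 2)) (at z)"
    and eq: "\<And>z. Phi z = 1 / 2 + 1 / complex_of_real (sqrt (2 * pi)) * (P z - P 0)"
    using Phi_primitive by blast
  have "((\<lambda>z. 1 / 2 + 1 / complex_of_real (sqrt (2 * pi)) * (P z - P 0)) has_field_derivative
      exp (- (z\<^sup>2) / 2) / complex_of_real (sqrt (2 * pi))) (at z)"
    by (rule derivative_eq_intros P refl | simp)+
  thus ?thesis unfolding eq[symmetric] .
qed

lemma Phi_holomorphic: "Phi holomorphic_on S"
  using Phi_has_field_derivative field_differentiable_at_within field_differentiable_def
  by (metis holomorphic_on_def)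

lemma continuous_on_Phi [continuous_intros]:
  "continuous_on S f \<Longrightarrow> continuous_on S (\<lambda>x. Phi (f x))"
  using continuous_on_compose2[OF holomorphic_on_imp_continuous_on[OF Phi_holomorphic[of UNIV]]] by blast

lemma Phi_measurable [measurable]: "Phi \<in> borel_measurable borel"
  by (intro borel_measurable_continuous_onI continuous_on_Phi continuous_on_id)

lemma Phi_0 [simp]: "Phi 0 = 1 / 2"
  by (simp add: Phi_def)

lemma entire_eqI:
  fixes f g :: "complex \<Rightarrow> complex"
  assumes "\<And>z. (f has_field_derivative h z) (at z)" "\<And>z. (g has_field_derivative h z) (at z)" "f 0 = g 0"
  shows "f z = g z"
proof -
  have "((\<lambda>z. f z - g z) has_field_derivative 0) (at z)" for z
    using DERIV_diff[OF assms(1,2)] by simp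
  then obtain c where "\<And>z. f z - g z = c"
    using has_field_derivative_zero_constant[of UNIV "\<lambda>z. f z - g z"] by auto
  from this[of z] this[of 0] show ?thesis using assms(3) by simp
qed

lemma Phi_minus: "Phi (- z) = 1 - Phi z"
proof (rule entire_eqI[where f = "\<lambda>z. Phi (- z)" and g = "\<lambda>z. 1 - Phi z"])
  show "((\<lambda>z. Phi (- z)) has_field_derivative - (exp (- (z\<^sup>2) / 2) / complex_of_real (sqrt (2 * pi)))) (at z)" for z
    using DERIV_chain'[OF DERIV_minus[OF DERIV_ident] Phi_has_field_derivative, of z] by simp
  show "((\<lambda>z. 1 - Phi z) has_field_derivative - (exp (- (z\<^sup>2) / 2) / complex_of_real (sqrt (2 * pi)))) (at z)" for z
    using DERIV_diff[OF DERIV_const Phi_has_field_derivative, of 1 z] by simp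
qed simp

lemma Phi_cnj: "Phi (cnj z) = cnj (Phi z)"
proof -
  have "(cnj \<circ> Phi \<circ> cnj) z = Phi z" for z
  proof (rule entire_eqI[OF _ Phi_has_field_derivative])
    show "(cnj \<circ> Phi \<circ> cnj has_field_derivative exp (- (z\<^sup>2) / 2) / complex_of_real (sqrt (2 * pi))) (at z)" for z
      using has_field_derivative_cnj_cnj[OF Phi_has_field_derivative[of "cnj z"]] by (simp add: exp_cnj)
  qed simp
  from this[of "cnj z"] show ?thesis by simp
qed

section \<open>Complex exponentials under the normal law\<close>

lemma integrable_exp_std_normal:
  fixes b :: complex
  shows "integrable std_normal_distribution (\<lambda>x. exp (b * complex_of_real x))"
proof -
  have "integrable lborel (\<lambda>x. std_normal_density x *\<^sub>R exp (b * complex_of_real x))"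
  proof (rule Bochner_Integration.integrable_bound)
    show "integrable lborel (\<lambda>x. exp ((Re b)\<^sup>2 / 2) * normal_density (Re b) 1 x)" by simp
    have "norm (std_normal_density x *\<^sub>R exp (b * complex_of_real x)) = exp ((Re b)\<^sup>2 / 2) * normal_density (Re b) 1 x" for x
      by (simp add: normal_density_def exp_add[symmetric]) (simp add: power2_eq_square field_simps)
    thus "AE x in lborel. norm (std_normal_density x *\<^sub>R exp (b * complex_of_real x))
        \<le> norm (exp ((Re b)\<^sup>2 / 2) * normal_density (Re b) 1 x)" by simp
  qed measurable
  thus ?thesis by (subst integrable_density) auto
qed


lemma norm_exp_neg_square: "norm (exp (- (z\<^sup>2) / 2)) = exp (((Im z)\<^sup>2 - (Re z)\<^sup>2) / 2)"
  by (simp add: power2_eq_square field_simps)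

text \<open>The derivative of \<open>Phi\<close> is bounded by a Gaussian in \<open>u\<close> on the
  whole vertical segment. For fixed \<open>y\<close> the bound tends to zero as \<open>u\<close>
  goes to minus infinity, which carries limits from the real axis to parallel lines.\<close>

lemma Phi_vertical_bound:
  "norm (Phi (complex_of_real u + \<i> * complex_of_real y) - Phi (complex_of_real u))
     \<le> exp ((y\<^sup>2 - u\<^sup>2) / 2) / sqrt (2 * pi) * \<bar>y\<bar>"
proof -
  let ?S = "closed_segment (complex_of_real u) (complex_of_real u + \<i> * complex_of_real y)"
  have "norm (Phi (complex_of_real u + \<i> * complex_of_real y) - Phi (complex_of_real u))
     \<le> exp ((y\<^sup>2 - u\<^sup>2) / 2) / sqrt (2 * pi) * norm ((complex_of_real u + \<i> * complex_of_real y) - complex_of_real u)"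
  proof (rule field_differentiable_bound[where S = ?S and f = Phi])
    fix z assume "z \<in> ?S"
    then obtain s where s: "0 \<le> s" "s \<le> 1" "z = (1 - s) *\<^sub>R complex_of_real u + s *\<^sub>R (complex_of_real u + \<i> * complex_of_real y)"
      by (auto simp: in_segment)
    have z: "Re z = u" "Im z = s * y" using s by (auto simp: algebra_simps)
    have "(s * y)\<^sup>2 \<le> 1\<^sup>2 * y\<^sup>2"
      unfolding power_mult_distrib using s by (intro mult_right_mono power_mono) auto
    hence "norm (exp (- (z\<^sup>2) / 2)) \<le> exp ((y\<^sup>2 - u\<^sup>2) / 2)"
      unfolding norm_exp_neg_square z by simp
    thus "norm (exp (- (z\<^sup>2) / 2) / complex_of_real (sqrt (2 * pi))) \<le> exp ((y\<^sup>2 - u\<^sup>2) / 2) / sqrt (2 * pi)"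
      by (simp only: norm_divide norm_of_real) (simp add: divide_right_mono)
    show "(Phi has_field_derivative exp (- (z\<^sup>2) / 2) / complex_of_real (sqrt (2 * pi))) (at z within ?S)"
      by (rule has_field_derivative_at_within[OF Phi_has_field_derivative])
  qed auto
  thus ?thesis by (simp add: norm_mult)
qed

text \<open>Completing the square, \<open>b * x - x^2 / 2 = b^2 / 2 - (x - b)^2 / 2\<close>,
  exhibits \<open>exp (b^2 / 2) * Phi (x - b)\<close> as a primitive, also for complex
  \<open>b\<close>.\<close>

lemma std_normal_tilt_interval:
  fixes b :: complex
  assumes "a \<le> t"
  shows "(LBINT x:{a..t}. std_normal_density x *\<^sub>R exp (b * complex_of_real x))
    = exp (b\<^sup>2 / 2) * Phi (complex_of_real t - b) - exp (b\<^sup>2 / 2) * Phi (complex_of_real a - b)"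
  unfolding set_lebesgue_integral_def
proof (rule integral_FTC_atLeastAtMost[OF assms])
  fix x :: real
  have "((\<lambda>z. exp (b\<^sup>2 / 2) * Phi (z - b)) has_field_derivative
      exp (b\<^sup>2 / 2) * (exp (- ((complex_of_real x - b)\<^sup>2) / 2) / complex_of_real (sqrt (2 * pi)))) (at (complex_of_real x))"
    by (intro DERIV_cmult DERIV_chain'[OF _ Phi_has_field_derivative, THEN DERIV_cong])
      (auto intro!: derivative_eq_intros)
  also have "exp (b\<^sup>2 / 2) * (exp (- ((complex_of_real x - b)\<^sup>2) / 2) / complex_of_real (sqrt (2 * pi)))
      = std_normal_density x *\<^sub>R exp (b * complex_of_real x)"
    by (simp add: std_normal_density_def scaleR_conv_of_real exp_of_real[symmetric] exp_add[symmetric] del: exp_of_real)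
      (simp add: power2_eq_square field_simps)
  finally show "((\<lambda>x. exp (b\<^sup>2 / 2) * Phi (complex_of_real x - b)) has_vector_derivative
      std_normal_density x *\<^sub>R exp (b * complex_of_real x)) (at x within {a..t})"
    by (rule has_vector_derivative_real_field)
next
  show "continuous_on {a..t} (\<lambda>x. std_normal_density x *\<^sub>R exp (b * complex_of_real x))"
    unfolding std_normal_density_def by (intro continuous_intros) auto
qed

lemma set_integrable_std_normal_tilt:
  fixes b :: complex
  assumes "S \<in> sets borel"
  shows "set_integrable lborel S (\<lambda>x. std_normal_density x *\<^sub>R exp (b * complex_of_real x))"
proof -
  have "integrable lborel (\<lambda>x. std_normal_density x *\<^sub>R exp (b * complex_of_real x))"
    using integrable_exp_std_normal[of b] by (subst (asm) integrable_density) auto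
  thus ?thesis unfolding set_integrable_def using assms by (intro integrable_mult_indicator) auto
qed

lemma std_normal_half: "(LBINT x:{..0}. std_normal_density x) = 1 / 2"
proof -
  have "(LBINT x:{..0}. std_normal_density x) = (\<integral>x. indicator {0..} x * std_normal_density x \<partial>lborel)"
    unfolding set_lebesgue_integral_def
    by (subst lborel_integral_real_affine[where c = "-1" and t = 0])
      (auto simp: normal_density_def indicator_def intro!: Bochner_Integration.integral_cong)
  moreover have "(LBINT x:{..0}. std_normal_density x) + (\<integral>x. indicator {0..} x * std_normal_density x \<partial>lborel)
      = (\<integral>x. indicator {..0} x * std_normal_density x + indicator {0..} x * std_normal_density x \<partial>lborel)"
    unfolding set_lebesgue_integral_def real_scaleR_def
    by (intro Bochner_Integration.integral_add[symmetric] integrable_mult_indicator[where 'b = real, unfolded real_scaleR_def]) auto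
  moreover have "\<dots> = (\<integral>x. std_normal_density x \<partial>lborel)"
  proof (rule integral_cong_AE)
    have "AE x in lborel. x \<noteq> (0::real)" by (rule AE_lborel_singleton)
    thus "AE x in lborel. indicator {..0} x * std_normal_density x + indicator {0..} x * std_normal_density x = std_normal_density x"
      by eventually_elim (auto simp: indicator_def)
  qed auto
  ultimately show ?thesis by simp
qed

text \<open>On the real axis, zero tilt gives \<open>Phi a\<close> as \<open>1 / 2\<close> minus the
  normal mass of \<open>[a, 0]\<close>, which tends to \<open>1 / 2\<close>; this is where the
  additive constant of \<open>Phi\<close> matters. The imaginary part of \<open>b\<close> is
  absorbed by the vertical bound.\<close>

lemma Phi_tendsto_0_at_bot: "((\<lambda>x. Phi (complex_of_real x - b)) \<longlongrightarrow> 0) at_bot"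
proof -
  have r: "((\<lambda>x. Phi (complex_of_real x)) \<longlongrightarrow> 0) at_bot"
  proof -
    have "((\<lambda>a. LBINT x:{a..0}. std_normal_density x *\<^sub>R exp (0 * complex_of_real x)) \<longlongrightarrow>
        (LBINT x:{..0}. std_normal_density x *\<^sub>R exp (0 * complex_of_real x))) at_bot"
      by (intro tendsto_set_lebesgue_integral_at_bot set_integrable_std_normal_tilt) auto
    also have "(LBINT x:{..0}. std_normal_density x *\<^sub>R exp (0 * complex_of_real x)) = complex_of_real (LBINT x:{..0}. std_normal_density x)"
      unfolding set_lebesgue_integral_def
      by (subst integral_complex_of_real[symmetric]) (auto simp: scaleR_conv_of_real intro!: Bochner_Integration.integral_cong)
    finally have "((\<lambda>a. 1 / 2 - (LBINT x:{a..0}. std_normal_density x *\<^sub>R exp (0 * complex_of_real x))) \<longlongrightarrow> 1 / 2 - 1 / 2) at_bot"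
      unfolding std_normal_half by (intro tendsto_diff tendsto_const) simp
    moreover have "\<forall>\<^sub>F a in at_bot. 1 / 2 - (LBINT x:{a..0}. std_normal_density x *\<^sub>R exp (0 * complex_of_real x)) = Phi (complex_of_real a)"
      using eventually_le_at_bot[of 0] by eventually_elim (subst std_normal_tilt_interval, auto)
    ultimately show ?thesis by (simp add: tendsto_cong)
  qed
  have "((\<lambda>x. Phi (complex_of_real (x - Re b))) \<longlongrightarrow> 0) at_bot"
    by (rule filterlim_compose[OF r]) real_asymp
  moreover have "((\<lambda>x. Phi (complex_of_real (x - Re b) + \<i> * complex_of_real (- Im b)) - Phi (complex_of_real (x - Re b))) \<longlongrightarrow> 0) at_bot"
  proof (rule Lim_null_comparison)
    show "\<forall>\<^sub>F x in at_bot. norm (Phi (complex_of_real (x - Re b) + \<i> * complex_of_real (- Im b)) - Phi (complex_of_real (x - Re b)))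
       \<le> exp (((- Im b)\<^sup>2 - (x - Re b)\<^sup>2) / 2) / sqrt (2 * pi) * \<bar>- Im b\<bar>"
      by (intro always_eventually allI Phi_vertical_bound)
    show "((\<lambda>x. exp (((- Im b)\<^sup>2 - (x - Re b)\<^sup>2) / 2) / sqrt (2 * pi) * \<bar>- Im b\<bar>) \<longlongrightarrow> 0) at_bot"
      by real_asymp
  qed
  ultimately have "((\<lambda>x. (Phi (complex_of_real (x - Re b) + \<i> * complex_of_real (- Im b)) - Phi (complex_of_real (x - Re b)))
      + Phi (complex_of_real (x - Re b))) \<longlongrightarrow> 0 + 0) at_bot"
    by (intro tendsto_add)
  moreover have "complex_of_real (x - Re b) + \<i> * complex_of_real (- Im b) = complex_of_real x - b" for x
    by (simp add: complex_eq_iff)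
  ultimately show ?thesis by (simp only: diff_add_cancel add_0_left)
qed

lemma std_normal_tilt_atMost:
  fixes b :: complex
  shows "(CLINT x|std_normal_distribution. indicator {..t} x *\<^sub>R exp (b * complex_of_real x))
    = exp (b\<^sup>2 / 2) * Phi (complex_of_real t - b)"
proof -
  let ?I = "LBINT x:{..t}. std_normal_density x *\<^sub>R exp (b * complex_of_real x)"
  have "((\<lambda>a. LBINT x:{a..t}. std_normal_density x *\<^sub>R exp (b * complex_of_real x)) \<longlongrightarrow> ?I) at_bot"
    by (intro tendsto_set_lebesgue_integral_at_bot set_integrable_std_normal_tilt) auto
  moreover have "\<forall>\<^sub>F a in at_bot. (LBINT x:{a..t}. std_normal_density x *\<^sub>R exp (b * complex_of_real x))
      = exp (b\<^sup>2 / 2) * Phi (complex_of_real t - b) - exp (b\<^sup>2 / 2) * Phi (complex_of_real a - b)"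
    using eventually_le_at_bot[of t] by eventually_elim (rule std_normal_tilt_interval)
  ultimately have "((\<lambda>a. exp (b\<^sup>2 / 2) * Phi (complex_of_real t - b) - exp (b\<^sup>2 / 2) * Phi (complex_of_real a - b)) \<longlongrightarrow> ?I) at_bot"
    by (rule Lim_transform_eventually)
  moreover have "((\<lambda>a. exp (b\<^sup>2 / 2) * Phi (complex_of_real t - b) - exp (b\<^sup>2 / 2) * Phi (complex_of_real a - b)) \<longlongrightarrow>
      exp (b\<^sup>2 / 2) * Phi (complex_of_real t - b) - exp (b\<^sup>2 / 2) * 0) at_bot"
    by (intro tendsto_intros Phi_tendsto_0_at_bot)
  ultimately have "?I = exp (b\<^sup>2 / 2) * Phi (complex_of_real t - b)"
    using tendsto_unique trivial_limit_at_bot_linorder by fastforce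
  thus ?thesis
    by (subst integral_density) (auto simp: set_lebesgue_integral_def mult_ac)
qed

lemma std_normal_reflect:
  fixes f :: "real \<Rightarrow> 'b :: {banach, second_countable_topology}"
  assumes [measurable]: "f \<in> borel_measurable borel"
  shows "(\<integral>x. f (- x) \<partial>std_normal_distribution) = (\<integral>x. f x \<partial>std_normal_distribution)"
proof -
  have "(\<integral>x. f x \<partial>std_normal_distribution) = (\<integral>x. std_normal_density x *\<^sub>R f x \<partial>lborel)"
    by (subst integral_density) auto
  also have "\<dots> = (\<integral>x. std_normal_density x *\<^sub>R f (- x) \<partial>lborel)"
    by (subst lborel_integral_real_affine[where c = "-1" and t = 0]) (auto simp: normal_density_def)
  also have "\<dots> = (\<integral>x. f (- x) \<partial>std_normal_distribution)"
    by (subst integral_density) auto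
  finally show ?thesis ..
qed

lemma std_normal_tilt_halfline:
  fixes b :: complex and \<epsilon> t :: real
  assumes "\<epsilon> \<in> {-1, 1}"
  shows "(CLINT x|std_normal_distribution. indicator {x. \<epsilon> * x \<le> t} x *\<^sub>R exp (b * complex_of_real x))
    = exp (b\<^sup>2 / 2) * Phi (complex_of_real t - complex_of_real \<epsilon> * b)"
proof (cases "\<epsilon> = 1")
  case True
  thus ?thesis using std_normal_tilt_atMost[of t b] by (simp add: atMost_def)
next
  case False
  hence e: "\<epsilon> = -1" using assms by simp
  have "(CLINT x|std_normal_distribution. indicator {x. \<epsilon> * x \<le> t} x *\<^sub>R exp (b * complex_of_real x))
     = (CLINT x|std_normal_distribution. indicator {..t} (- x) *\<^sub>R exp ((- b) * complex_of_real (- x)))"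
    by (intro Bochner_Integration.integral_cong) (auto simp: e indicator_def)
  also have "\<dots> = (CLINT x|std_normal_distribution. indicator {..t} x *\<^sub>R exp ((- b) * complex_of_real x))"
    by (rule std_normal_reflect) measurable
  finally show ?thesis using std_normal_tilt_atMost[of t "-b"] e by simp
qed

text \<open>Splitting at \<open>0\<close> gives two half-line integrals that add up through
  \<open>Phi (- b) + Phi b = 1\<close>; the point counted twice is a null set.\<close>

lemma std_normal_tilt:
  fixes b :: complex
  shows "(CLINT x|std_normal_distribution. exp (b * complex_of_real x)) = exp (b\<^sup>2 / 2)"
proof -
  let ?N = std_normal_distribution
  let ?f = "\<lambda>x. exp (b * complex_of_real x)"
  let ?A = "{x. 1 * x \<le> (0::real)}" and ?B = "{x. - 1 * x \<le> (0::real)}"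
  have i: "integrable ?N (\<lambda>x. indicator S x *\<^sub>R ?f x)" if "S \<in> sets borel" for S
    using that by (intro integrable_mult_indicator integrable_exp_std_normal) auto
  have "(CLINT x|?N. ?f x) = (CLINT x|?N. indicator ?A x *\<^sub>R ?f x + indicator ?B x *\<^sub>R ?f x)"
  proof (rule integral_cong_AE)
    have "AE x in ?N. x \<noteq> 0"
      using AE_lborel_singleton[of 0] by (subst AE_density) (auto elim: eventually_mono)
    thus "AE x in ?N. ?f x = indicator ?A x *\<^sub>R ?f x + indicator ?B x *\<^sub>R ?f x"
      by eventually_elim (auto simp: indicator_def)
  qed measurable
  also have "\<dots> = (CLINT x|?N. indicator ?A x *\<^sub>R ?f x) + (CLINT x|?N. indicator ?B x *\<^sub>R ?f x)"
    by (intro Bochner_Integration.integral_add i) measurable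
  also have "\<dots> = exp (b\<^sup>2 / 2) * (Phi (- b) + Phi b)"
    using std_normal_tilt_halfline[of 1 0 b] std_normal_tilt_halfline[of "-1" 0 b]
    by (simp add: distrib_left)
  also have "\<dots> = exp (b\<^sup>2 / 2)" by (simp add: Phi_minus)
  finally show ?thesis .
qed

section \<open>Bounds for \<open>Phi\<close>\<close>

text \<open>The tilt \<open>b\<close> is the purely imaginary number with
  \<open>Re z - b = z\<close>. The integrand then has modulus at most one, and
  \<open>exp (b^2 / 2) = exp (- (Im z)^2 / 2)\<close>.\<close>

lemma norm_Phi_le: "norm (Phi z) \<le> exp ((Im z)\<^sup>2 / 2)"
proof -
  let ?N = std_normal_distribution
  interpret N: prob_space ?N by (rule prob_std_normal)
  define b where "b = - \<i> * complex_of_real (Im z)"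
  have "exp (b\<^sup>2 / 2) * Phi z = exp (b\<^sup>2 / 2) * Phi (complex_of_real (Re z) - b)"
    by (simp add: b_def complex_eq_iff[of z] flip: complex_eq)
  also have "\<dots> = (CLINT x|?N. indicator {..Re z} x *\<^sub>R exp (b * complex_of_real x))"
    by (rule std_normal_tilt_atMost[symmetric])
  finally have "norm (exp (b\<^sup>2 / 2) * Phi z) \<le> (\<integral>x. norm (indicator {..Re z} x *\<^sub>R exp (b * complex_of_real x)) \<partial>?N)"
    by (simp only: integral_norm_bound)
  also have "\<dots> \<le> (\<integral>x. 1 \<partial>?N)"
    by (intro integral_mono N.integrable_const_bound[where B = 1])
      (auto simp: b_def indicator_def)
  also have "\<dots> = 1" using N.prob_space by simp
  finally have "exp (- ((Im z)\<^sup>2) / 2) * norm (Phi z) \<le> 1"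
    by (simp add: norm_mult b_def power_mult_distrib)
  hence "exp ((Im z)\<^sup>2 / 2) * (exp (- ((Im z)\<^sup>2) / 2) * norm (Phi z)) \<le> exp ((Im z)\<^sup>2 / 2) * 1"
    by (intro mult_left_mono) auto
  thus ?thesis by (simp add: mult.assoc[symmetric] exp_add[symmetric])
qed

text \<open>A Chernoff bound: the real tilt \<open>exp (t * x)\<close> is at most one on
  \<open>{..0}\<close>, and its normalisation supplies the Gaussian factor.\<close>

lemma norm_Phi_minus_le:
  assumes "t \<ge> 0"
  shows "norm (Phi (complex_of_real (- t))) \<le> exp (- (t\<^sup>2) / 2)"
proof -
  let ?N = std_normal_distribution
  interpret N: prob_space ?N by (rule prob_std_normal)
  have "exp ((complex_of_real t)\<^sup>2 / 2) * Phi (complex_of_real (- t)) = (CLINT x|?N. indicator {..0} x *\<^sub>R exp (complex_of_real t * complex_of_real x))"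
    using std_normal_tilt_atMost[of 0 "complex_of_real t"] by simp
  hence "norm (exp ((complex_of_real t)\<^sup>2 / 2) * Phi (complex_of_real (- t))) \<le> (\<integral>x. norm (indicator {..0} x *\<^sub>R exp (complex_of_real t * complex_of_real x)) \<partial>?N)"
    by (simp only: integral_norm_bound)
  also have "\<dots> \<le> (\<integral>x. 1 \<partial>?N)"
    using assms by (intro integral_mono N.integrable_const_bound[where B = 1])
      (auto simp: indicator_def mult_nonneg_nonpos)
  also have "\<dots> = 1" using N.prob_space by simp
  finally have "exp (t\<^sup>2 / 2) * norm (Phi (complex_of_real (- t))) \<le> 1"
    by (simp add: norm_mult)
  hence "exp (- (t\<^sup>2) / 2) * (exp (t\<^sup>2 / 2) * norm (Phi (complex_of_real (- t)))) \<le> exp (- (t\<^sup>2) / 2) * 1"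
    by (intro mult_left_mono) auto
  thus ?thesis by (simp add: mult.assoc[symmetric] exp_add[symmetric])
qed

lemma Phi_of_real: "Phi (complex_of_real t) = complex_of_real (measure std_normal_distribution {..t})"
  using std_normal_tilt_atMost[of t 0]
  by (simp add: scaleR_conv_of_real)

section \<open>Gaussian vectors with a central parameter of either sign\<close>

text \<open>The scale is fixed by \<open>(1 - \<beta>) * \<rho>\<^sup>2 = 1\<close>: substituting
  \<open>x = \<rho> * y\<close> absorbs the quadratic term into the density and leaves a linear tilt
  by \<open>b * \<rho>\<close>.\<close>

lemma std_normal_gaussian_integral:
  fixes b :: complex and \<beta> :: real
  assumes "\<beta> < 1"
  defines "\<rho> \<equiv> 1 / sqrt (1 - \<beta>)"
  shows "(CLINT x|std_normal_distribution. exp (complex_of_real (\<beta> * x\<^sup>2 / 2) + b * complex_of_real x))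
    = complex_of_real \<rho> * exp (b\<^sup>2 * complex_of_real (\<rho>\<^sup>2) / 2)"
proof -
  have \<rho>: "\<rho> > 0" "\<rho>\<^sup>2 = 1 / (1 - \<beta>)" using assms by (auto simp: power_divide)
  have e: "std_normal_density (\<rho> * y) *\<^sub>R exp (complex_of_real (\<beta> * (\<rho> * y)\<^sup>2 / 2) + b * complex_of_real (\<rho> * y))
      = std_normal_density y *\<^sub>R exp (b * complex_of_real \<rho> * complex_of_real y)" for y
  proof -
    have "- ((\<rho> * y)\<^sup>2) / 2 + \<beta> * (\<rho> * y)\<^sup>2 / 2 = - (((1 - \<beta>) * \<rho>\<^sup>2) * y\<^sup>2) / 2"
      by (simp add: power_mult_distrib field_simps)
    also have "(1 - \<beta>) * \<rho>\<^sup>2 = 1" using assms \<rho>(2) by simp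
    finally have *: "exp (- ((\<rho> * y)\<^sup>2) / 2) * exp (\<beta> * (\<rho> * y)\<^sup>2 / 2) = exp (- (y\<^sup>2) / 2)"
      unfolding exp_add[symmetric] by simp
    have "std_normal_density (\<rho> * y) * exp (\<beta> * (\<rho> * y)\<^sup>2 / 2) = std_normal_density y"
      unfolding std_normal_density_def mult.assoc * ..
    hence "complex_of_real (std_normal_density (\<rho> * y)) * exp (complex_of_real (\<beta> * (\<rho> * y)\<^sup>2 / 2))
        = complex_of_real (std_normal_density y)"
      by (metis exp_of_real of_real_mult)
    thus ?thesis by (simp add: scaleR_conv_of_real exp_add mult.assoc[symmetric])
  qed
  have "(CLINT x|std_normal_distribution. exp (complex_of_real (\<beta> * x\<^sup>2 / 2) + b * complex_of_real x))
    = (CLINT x|lborel. std_normal_density x *\<^sub>R exp (complex_of_real (\<beta> * x\<^sup>2 / 2) + b * complex_of_real x))"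
    by (subst integral_density) auto
  also have "\<dots> = \<rho> *\<^sub>R (CLINT y|lborel. std_normal_density (\<rho> * y) *\<^sub>R exp (complex_of_real (\<beta> * (\<rho> * y)\<^sup>2 / 2) + b * complex_of_real (\<rho> * y)))"
    using \<rho> by (subst lborel_integral_real_affine[where c = \<rho> and t = 0]) auto
  also have "\<dots> = \<rho> *\<^sub>R (CLINT y|std_normal_distribution. exp (b * complex_of_real \<rho> * complex_of_real y))"
    unfolding e by (subst integral_density) auto
  finally show ?thesis
    unfolding std_normal_tilt by (simp add: power_mult_distrib scaleR_conv_of_real)
qed

lemma integrable_std_normal_exp_square:
  fixes \<beta> :: real
  assumes "\<beta> < 1"
  shows "integrable std_normal_distribution (\<lambda>x. exp (\<beta> * x\<^sup>2 / 2))"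
proof -
  define \<rho> where "\<rho> = 1 / sqrt (1 - \<beta>)"
  have \<rho>: "\<rho> > 0" "\<rho>\<^sup>2 = 1 / (1 - \<beta>)" using assms by (auto simp: \<rho>_def power_divide)
  have "std_normal_density x * exp (\<beta> * x\<^sup>2 / 2) = \<rho> * normal_density 0 \<rho> x" for x
  proof -
    have "std_normal_density x * exp (\<beta> * x\<^sup>2 / 2) = 1 / sqrt (2 * pi) * exp (- (x\<^sup>2) / (2 * \<rho>\<^sup>2))"
      using assms unfolding std_normal_density_def mult.assoc exp_add[symmetric] \<rho>(2)
      by (simp add: field_simps)
    thus ?thesis using \<rho>(1) by (simp add: normal_density_def real_sqrt_mult)
  qed
  hence "integrable lborel (\<lambda>x. std_normal_density x * exp (\<beta> * x\<^sup>2 / 2))"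
    using \<rho> by simp
  thus ?thesis by (subst integrable_density) auto
qed

lemma std_normal_tilt_real: "(\<integral>x. exp (a * x) \<partial>std_normal_distribution) = exp (a\<^sup>2 / 2)"
proof -
  have "complex_of_real (\<integral>x. exp (a * x) \<partial>std_normal_distribution) = complex_of_real (exp (a\<^sup>2 / 2))"
    using std_normal_tilt[of "complex_of_real a"]
    by (subst integral_complex_of_real[symmetric]) (simp add: exp_of_real[symmetric] del: exp_of_real)
  thus ?thesis by (simp only: of_real_eq_iff)
qed

text \<open>Writing \<open>\<xi>\<close> for independent standard normal variables, the density \<open>mix_density\<close> makes
  \<open>\<xi> j / sqrt (lam j)\<close> a Gaussian vector with covariance \<open>1 / c + (if i = j then 1 / lam i else 0)\<close>.
  With \<open>\<theta>\<^sup>2 = 1 / c\<close>, formally \<open>\<xi> j\<close> is a standard normal variable shifted by \<open>\<theta> * sqrt (lam j) * x\<close>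
  with \<open>x\<close> standard normal; for \<open>c < 0\<close> the shift is imaginary, and it is encoded by the
  exponential \<open>mix_tilt\<close>.\<close>

locale gaussian_mixture =
  fixes J :: "nat set" and lam :: "nat \<Rightarrow> real" and c :: real
  assumes fin: "finite J" and lam_pos: "\<And>j. j \<in> J \<Longrightarrow> lam j > 0"
    and c: "c > 0 \<or> c < - (\<Sum>j\<in>J. lam j)"
begin

text \<open>The half-line formula has argument \<open>t - \<epsilon> * b\<close>; the minus sign
  here makes it produce \<open>\<epsilon> j * sqrt_quot (lam j) c * x\<close> without a
  reflection.\<close>

definition \<theta> :: complex where "\<theta> = - (1 / csqrt (complex_of_real c))"

definition W :: "(nat \<Rightarrow> real) \<Rightarrow> real" where "W \<xi> = (\<Sum>j\<in>J. sqrt (lam j) * \<xi> j)"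

definition \<Lambda> :: real where "\<Lambda> = (\<Sum>j\<in>J. lam j)"

text \<open>In the coordinates \<open>\<xi>\<close> the wanted covariance is
  \<open>I + v v^T / c\<close> with \<open>v j = sqrt (lam j)\<close>. Its inverse
  \<open>I - v v^T / (c + \<Lambda>)\<close> explains the exponent, and its determinant
  \<open>(c + \<Lambda>) / c\<close> the prefactor.\<close>

definition mix_density :: "(nat \<Rightarrow> real) \<Rightarrow> real" where
  "mix_density \<xi> = sqrt (c / (c + \<Lambda>)) * exp ((W \<xi>)\<^sup>2 / (2 * (c + \<Lambda>)))"

abbreviation normals :: "(nat \<Rightarrow> real) measure" where
  "normals \<equiv> Pi\<^sub>M J (\<lambda>_. std_normal_distribution)"

definition mix :: "(nat \<Rightarrow> real) measure" where "mix = density normals mix_density"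

text \<open>For \<open>b = \<theta> * sqrt (lam j) * x\<close> this is
  \<open>exp (b * y - b^2 / 2)\<close>, the likelihood ratio of a shift by \<open>b\<close>,
  normalised to mean one even for imaginary \<open>b\<close>.\<close>

definition tilt1 :: "nat \<Rightarrow> real \<Rightarrow> real \<Rightarrow> complex" where
  "tilt1 j x y = exp (\<theta> * complex_of_real (sqrt (lam j) * x) * complex_of_real y - complex_of_real (lam j * x\<^sup>2 / (2 * c)))"

definition mix_tilt :: "real \<Rightarrow> (nat \<Rightarrow> real) \<Rightarrow> complex" where
  "mix_tilt x \<xi> = (\<Prod>j\<in>J. tilt1 j x (\<xi> j))"

lemma \<Lambda>_nonneg: "\<Lambda> \<ge> 0"
  unfolding \<Lambda>_def using lam_pos by (intro sum_nonneg) (auto intro: less_imp_le)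

lemma c_nz: "c \<noteq> 0" and s_pos: "(c + \<Lambda>) / c > 0" and s_nz: "c + \<Lambda> \<noteq> 0"
proof -
  show "c \<noteq> 0" using c \<Lambda>_nonneg unfolding \<Lambda>_def by linarith
  from c have "(c > 0 \<and> c + \<Lambda> > 0) \<or> (c < 0 \<and> c + \<Lambda> < 0)"
    using \<Lambda>_nonneg unfolding \<Lambda>_def by linarith
  thus "(c + \<Lambda>) / c > 0" "c + \<Lambda> \<noteq> 0" by (auto simp: zero_less_divide_iff)
qed

lemma \<theta>_square: "\<theta>\<^sup>2 = complex_of_real (1 / c)"
  by (simp add: \<theta>_def power_divide)

lemma Re_\<theta>_square: "(Re \<theta>)\<^sup>2 = (if c > 0 then 1 / c else 0)"
proof (cases "c > 0")
  case True
  hence "\<theta> = complex_of_real (- (1 / sqrt c))" by (simp add: \<theta>_def csqrt_of_real_nonneg)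
  hence "Re \<theta> = - (1 / sqrt c)" by (metis Re_complex_of_real)
  thus ?thesis using True by (simp add: power_divide)
next
  case False
  hence "\<theta> = - (1 / (\<i> * complex_of_real (sqrt (- c))))" by (simp add: \<theta>_def csqrt_of_real_nonpos)
  also have "\<dots> = \<i> * complex_of_real (1 / sqrt (- c))" by (simp add: divide_simps)
  finally have "Re \<theta> = 0" by simp
  thus ?thesis using False by simp
qed

lemma sets_normals [measurable_cong, simp]: "sets normals = sets (Pi\<^sub>M J (\<lambda>_. borel :: real measure))"
  by (intro sets_PiM_cong) auto

lemma component_measurable [measurable]: "j \<in> J \<Longrightarrow> (\<lambda>\<xi>. \<xi> j) \<in> borel_measurable (Pi\<^sub>M J (\<lambda>_. borel :: real measure))"
  by (rule measurable_component_singleton)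

lemma W_measurable [measurable]: "W \<in> borel_measurable (Pi\<^sub>M J (\<lambda>_. borel :: real measure))"
  unfolding W_def[abs_def] by measurable

lemma mix_density_measurable [measurable]: "mix_density \<in> borel_measurable (Pi\<^sub>M J (\<lambda>_. borel :: real measure))"
  unfolding mix_density_def[abs_def] by measurable

lemma mix_density_nonneg: "mix_density \<xi> \<ge> 0"
  using s_pos by (auto simp: mix_density_def zero_less_divide_iff zero_le_divide_iff)

lemma mix_tilt_measurable [measurable]:
  "(\<lambda>(x, \<xi>). mix_tilt x \<xi>) \<in> borel_measurable (borel \<Otimes>\<^sub>M Pi\<^sub>M J (\<lambda>_. borel :: real measure))"
  unfolding mix_tilt_def tilt1_def case_prod_beta by measurable

lemma tilt1_measurable [measurable]: "tilt1 j x \<in> borel_measurable borel"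
  unfolding tilt1_def[abs_def] by measurable

lemma integrable_tilt1: "integrable std_normal_distribution (tilt1 j x)"
  using integrable_exp_std_normal unfolding tilt1_def[abs_def] exp_diff
  by (intro integrable_divide_zero) auto

text \<open>For \<open>c > 0\<close> the tilt is a positive density and the exponent is zero. For
  \<open>c < 0\<close> it oscillates, and its absolute mean grows with \<open>x\<close>.\<close>

lemma integral_norm_tilt1:
  "(\<integral>y. norm (tilt1 j x y) \<partial>std_normal_distribution) = exp (((Re \<theta>)\<^sup>2 - 1 / c) * lam j * x\<^sup>2 / 2)" if "j \<in> J"
proof -
  have "norm (tilt1 j x y) = exp (Re \<theta> * (sqrt (lam j) * x) * y) * exp (- (lam j * x\<^sup>2 / (2 * c)))" for y
    by (simp add: tilt1_def exp_add[symmetric])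
  hence "(\<integral>y. norm (tilt1 j x y) \<partial>std_normal_distribution)
      = exp ((Re \<theta> * (sqrt (lam j) * x))\<^sup>2 / 2) * exp (- (lam j * x\<^sup>2 / (2 * c)))"
    using std_normal_tilt_real[of "Re \<theta> * (sqrt (lam j) * x)"] by simp
  also have "\<dots> = exp (((Re \<theta>)\<^sup>2 - 1 / c) * lam j * x\<^sup>2 / 2)"
    using lam_pos[OF that] by (simp add: exp_add[symmetric] power_mult_distrib) (simp add: algebra_simps)
  finally show ?thesis .
qed

lemma product_std_normal: "product_prob_space (\<lambda>_ :: nat. std_normal_distribution)"
  by (intro product_prob_spaceI prob_std_normal)

lemma pair_std_normal: "pair_sigma_finite std_normal_distribution normals"
  by (intro pair_sigma_finite.intro prob_space_imp_sigma_finite prob_space_PiM prob_std_normal)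

lemma integrable_mix_tilt_section: "integrable normals (mix_tilt x)"
proof -
  interpret product_prob_space "\<lambda>_ :: nat. std_normal_distribution" by (rule product_std_normal)
  show ?thesis unfolding mix_tilt_def[abs_def]
    by (intro product_integrable_prod fin integrable_tilt1)
qed

text \<open>Integrating the modulus over \<open>\<xi>\<close> leaves
  \<open>exp (\<beta> * x^2 / 2)\<close> with \<open>\<beta> = 0\<close> for \<open>c > 0\<close>
  and \<open>\<beta> = - \<Lambda> / c\<close> for \<open>c < 0\<close>. In the latter case
  \<open>c < - \<Lambda>\<close> says exactly that \<open>\<beta> < 1\<close>, the condition for
  integrability against the law of \<open>x\<close>.\<close>

lemma integrable_mix_tilt: "integrable (std_normal_distribution \<Otimes>\<^sub>M normals) (\<lambda>(x, \<xi>). mix_tilt x \<xi>)"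
proof -
  interpret product_prob_space "\<lambda>_ :: nat. std_normal_distribution" by (rule product_std_normal)
  interpret P: pair_sigma_finite std_normal_distribution normals by (rule pair_std_normal)
  define \<beta> where "\<beta> = ((Re \<theta>)\<^sup>2 - 1 / c) * \<Lambda>"
  have "\<beta> < 1"
  proof (cases "c > 0")
    case True
    thus ?thesis by (simp add: \<beta>_def Re_\<theta>_square)
  next
    case False
    thus ?thesis using c c_nz by (simp add: \<beta>_def Re_\<theta>_square \<Lambda>_def[symmetric] field_simps)
  qed
  have "(\<integral>\<xi>. norm (mix_tilt x \<xi>) \<partial>normals) = exp (\<beta> * x\<^sup>2 / 2)" for x
  proof -
    have "(\<integral>\<xi>. norm (mix_tilt x \<xi>) \<partial>normals) = (\<integral>\<xi>. (\<Prod>j\<in>J. norm (tilt1 j x (\<xi> j))) \<partial>normals)"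
      by (simp add: mix_tilt_def prod_norm)
    also have "\<dots> = (\<Prod>j\<in>J. exp (((Re \<theta>)\<^sup>2 - 1 / c) * lam j * x\<^sup>2 / 2))"
      by (subst product_integral_prod)
        (auto intro!: fin integrable_norm integrable_tilt1 prod.cong simp: integral_norm_tilt1)
    also have "\<dots> = exp (\<beta> * x\<^sup>2 / 2)"
      by (simp add: exp_sum[OF fin, symmetric] \<beta>_def \<Lambda>_def sum_distrib_left sum_distrib_right sum_divide_distrib)
    finally show ?thesis .
  qed
  thus ?thesis
    using integrable_std_normal_exp_square[OF \<open>\<beta> < 1\<close>] integrable_mix_tilt_section
    by (intro P.Fubini_integrable) auto
qed

lemma mix_tilt_eq_exp:
  "mix_tilt x \<xi> = exp (complex_of_real (- (\<Lambda> / c) * x\<^sup>2 / 2) + \<theta> * complex_of_real (W \<xi>) * complex_of_real x)"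
proof -
  have "(\<Sum>j\<in>J. \<theta> * complex_of_real (sqrt (lam j) * x) * complex_of_real (\<xi> j) - complex_of_real (lam j * x\<^sup>2 / (2 * c)))
      = \<theta> * complex_of_real (W \<xi>) * complex_of_real x - complex_of_real (\<Lambda> * x\<^sup>2 / (2 * c))"
    by (simp add: sum_subtractf W_def \<Lambda>_def sum_distrib_left sum_distrib_right sum_divide_distrib mult_ac)
  also have "\<dots> = complex_of_real (- (\<Lambda> / c) * x\<^sup>2 / 2) + \<theta> * complex_of_real (W \<xi>) * complex_of_real x"
    by simp
  finally show ?thesis unfolding mix_tilt_def tilt1_def exp_sum[OF fin, symmetric] by (rule arg_cong)
qed

text \<open>This is the linearisation of the square: in \<open>x\<close> the tilt is Gaussian with
  quadratic coefficient \<open>- \<Lambda> / c < 1\<close>, and integration returns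
  \<open>(W \<xi>)^2 / 2\<close> with the factor
  \<open>\<theta>^2 * c / (c + \<Lambda>) = 1 / (c + \<Lambda>)\<close>.\<close>

lemma integral_mix_tilt_fst:
  "(CLINT x|std_normal_distribution. mix_tilt x \<xi>) = complex_of_real (mix_density \<xi>)"
proof -
  have q: "1 - - (\<Lambda> / c) = (c + \<Lambda>) / c" using c_nz by (simp add: field_simps)
  have r: "(1 / sqrt ((c + \<Lambda>) / c))\<^sup>2 = c / (c + \<Lambda>)" using s_pos by (simp add: power_divide)
  have "- (\<Lambda> / c) < 1" using s_pos q by linarith
  hence "(CLINT x|std_normal_distribution. mix_tilt x \<xi>)
      = complex_of_real (1 / sqrt ((c + \<Lambda>) / c)) * exp ((\<theta> * complex_of_real (W \<xi>))\<^sup>2 * complex_of_real (c / (c + \<Lambda>)) / 2)"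
    unfolding mix_tilt_eq_exp using std_normal_gaussian_integral[of "- (\<Lambda> / c)" "\<theta> * complex_of_real (W \<xi>)"]
    unfolding q r by blast
  also have "(\<theta> * complex_of_real (W \<xi>))\<^sup>2 * complex_of_real (c / (c + \<Lambda>)) / 2 = complex_of_real ((W \<xi>)\<^sup>2 / (2 * (c + \<Lambda>)))"
    using c_nz s_nz unfolding power_mult_distrib \<theta>_square by simp
  also have "1 / sqrt ((c + \<Lambda>) / c) = sqrt (c / (c + \<Lambda>))" by (simp add: real_sqrt_divide)
  finally show ?thesis by (simp only: mix_density_def exp_of_real of_real_mult)
qed

lemma mix_bounded:
  fixes F :: "(nat \<Rightarrow> real) \<Rightarrow> complex"
  assumes F [measurable]: "F \<in> borel_measurable (Pi\<^sub>M J (\<lambda>_. borel :: real measure))"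
    and F1: "\<And>\<xi>. norm (F \<xi>) \<le> 1"
  shows "integrable (std_normal_distribution \<Otimes>\<^sub>M normals) (\<lambda>(x, \<xi>). F \<xi> * mix_tilt x \<xi>)"
    and "(\<integral>\<xi>. F \<xi> \<partial>mix) = (\<integral>x. (\<integral>\<xi>. F \<xi> * mix_tilt x \<xi> \<partial>normals) \<partial>std_normal_distribution)"
proof -
  interpret P: pair_sigma_finite std_normal_distribution normals by (rule pair_std_normal)
  have m: "(\<lambda>z. F (snd z)) \<in> borel_measurable (std_normal_distribution \<Otimes>\<^sub>M normals)"
    by (rule measurable_compose[OF measurable_snd]) measurable
  have m': "(\<lambda>z. mix_tilt (fst z) (snd z)) \<in> borel_measurable (std_normal_distribution \<Otimes>\<^sub>M normals)"
    using integrable_mix_tilt[THEN borel_measurable_integrable] by (simp add: case_prod_beta')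
  show i: "integrable (std_normal_distribution \<Otimes>\<^sub>M normals) (\<lambda>(x, \<xi>). F \<xi> * mix_tilt x \<xi>)"
  proof (rule Bochner_Integration.integrable_bound[OF integrable_mix_tilt])
    show "(\<lambda>(x, \<xi>). F \<xi> * mix_tilt x \<xi>) \<in> borel_measurable (std_normal_distribution \<Otimes>\<^sub>M normals)"
      unfolding case_prod_beta' using m m' by (rule borel_measurable_times)
    show "AE z in std_normal_distribution \<Otimes>\<^sub>M normals. norm (case z of (x, \<xi>) \<Rightarrow> F \<xi> * mix_tilt x \<xi>) \<le> norm (case z of (x, \<xi>) \<Rightarrow> mix_tilt x \<xi>)"
      using F1 by (intro always_eventually) (auto simp: norm_mult mult_left_le_one_le)
  qed
  have "(\<integral>\<xi>. F \<xi> \<partial>mix) = (\<integral>\<xi>. mix_density \<xi> *\<^sub>R F \<xi> \<partial>normals)"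
    unfolding mix_def using mix_density_nonneg by (intro integral_density) auto
  also have "\<dots> = (\<integral>\<xi>. (\<integral>x. F \<xi> * mix_tilt x \<xi> \<partial>std_normal_distribution) \<partial>normals)"
    by (simp add: integral_mix_tilt_fst scaleR_conv_of_real mult.commute)
  also have "\<dots> = (\<integral>x. (\<integral>\<xi>. F \<xi> * mix_tilt x \<xi> \<partial>normals) \<partial>std_normal_distribution)"
    using i by (rule P.Fubini_integral)
  finally show "(\<integral>\<xi>. F \<xi> \<partial>mix) = (\<integral>x. (\<integral>\<xi>. F \<xi> * mix_tilt x \<xi> \<partial>normals) \<partial>std_normal_distribution)" .
qed

text \<open>For fixed \<open>x\<close> both tilt and integrand are products over \<open>J\<close>,
  so the integral over \<open>normals\<close> factorises; the bound by one lets
  \<open>mix_tilt\<close> dominate, which justifies exchanging the integrals.\<close>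

lemma mix_prod:
  fixes f :: "nat \<Rightarrow> real \<Rightarrow> complex"
  assumes f: "\<And>j. j \<in> J \<Longrightarrow> f j \<in> borel_measurable borel"
    and f1: "\<And>j y. j \<in> J \<Longrightarrow> norm (f j y) \<le> 1"
    and K: "\<And>j x. j \<in> J \<Longrightarrow> (CLINT y|std_normal_distribution. f j y * tilt1 j x y) = K j x"
  shows "integrable std_normal_distribution (\<lambda>x. \<Prod>j\<in>J. K j x)"
    and "(\<integral>\<xi>. (\<Prod>j\<in>J. f j (\<xi> j)) \<partial>mix) = (CLINT x|std_normal_distribution. (\<Prod>j\<in>J. K j x))"
proof -
  interpret product_prob_space "\<lambda>_ :: nat. std_normal_distribution" by (rule product_std_normal)
  interpret P: pair_sigma_finite std_normal_distribution normals by (rule pair_std_normal)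
  have m: "(\<lambda>\<xi>. \<Prod>j\<in>J. f j (\<xi> j)) \<in> borel_measurable (Pi\<^sub>M J (\<lambda>_. borel :: real measure))"
    by (intro borel_measurable_prod measurable_compose[OF component_measurable] f)
  have b: "norm (\<Prod>j\<in>J. f j (\<xi> j)) \<le> 1" for \<xi>
    unfolding prod_norm[symmetric] using f1 by (intro prod_le_1) auto
  have inner: "(\<integral>\<xi>. (\<Prod>j\<in>J. f j (\<xi> j)) * mix_tilt x \<xi> \<partial>normals) = (\<Prod>j\<in>J. K j x)" for x
  proof -
    have "(\<integral>\<xi>. (\<Prod>j\<in>J. f j (\<xi> j)) * mix_tilt x \<xi> \<partial>normals) = (\<integral>\<xi>. (\<Prod>j\<in>J. f j (\<xi> j) * tilt1 j x (\<xi> j)) \<partial>normals)"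
      by (simp add: mix_tilt_def prod.distrib)
    also have "\<dots> = (\<Prod>j\<in>J. (CLINT y|std_normal_distribution. f j y * tilt1 j x y))"
    proof (rule product_integral_prod[OF fin])
      fix j assume j: "j \<in> J"
      have fm: "f j \<in> borel_measurable std_normal_distribution" using f[OF j] by simp
      show "integrable std_normal_distribution (\<lambda>y. f j y * tilt1 j x y)"
        using f1[OF j] fm
        by (intro Bochner_Integration.integrable_bound[OF integrable_tilt1[of j x]] always_eventually borel_measurable_times allI)
          (auto simp: norm_mult mult_left_le_one_le)
    qed
    finally show ?thesis using K by simp
  qed
  show "integrable std_normal_distribution (\<lambda>x. \<Prod>j\<in>J. K j x)"
    using P.integrable_fst'[OF mix_bounded(1)[OF m b]] by (simp add: inner)
  show "(\<integral>\<xi>. (\<Prod>j\<in>J. f j (\<xi> j)) \<partial>mix) = (CLINT x|std_normal_distribution. (\<Prod>j\<in>J. K j x))"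
    using mix_bounded(2)[OF m b] by (simp add: inner)
qed

text \<open>The factors may depend on the distinguished coordinate \<open>\<xi> i\<close>, so the
  others factorise only conditionally and that coordinate is integrated last. Half-lines with a
  threshold depending on \<open>\<xi> 0\<close> require this form.\<close>

lemma mix_prod_given:
  fixes f :: "nat \<Rightarrow> real \<Rightarrow> real \<Rightarrow> complex"
  assumes i: "i \<in> J"
    and g [measurable]: "g \<in> borel_measurable borel" and g1: "\<And>v. norm (g v) \<le> 1"
    and f: "\<And>j. j \<in> J - {i} \<Longrightarrow> (\<lambda>z. f j (fst z) (snd z)) \<in> borel_measurable (borel \<Otimes>\<^sub>M borel)"
    and f1: "\<And>j v y. j \<in> J - {i} \<Longrightarrow> norm (f j v y) \<le> 1"
    and K: "\<And>j v x. j \<in> J - {i} \<Longrightarrow> (CLINT y|std_normal_distribution. f j v y * tilt1 j x y) = K j v x"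
    and Km: "\<And>j x. j \<in> J - {i} \<Longrightarrow> (\<lambda>v. K j v x) \<in> borel_measurable borel"
  defines "H \<equiv> \<lambda>x. CLINT v|std_normal_distribution. g v * tilt1 i x v * (\<Prod>j\<in>J - {i}. K j v x)"
  shows "integrable std_normal_distribution H"
    and "(\<integral>\<xi>. g (\<xi> i) * (\<Prod>j\<in>J - {i}. f j (\<xi> i) (\<xi> j)) \<partial>mix) = (CLINT x|std_normal_distribution. H x)"
proof -
  interpret product_prob_space "\<lambda>_ :: nat. std_normal_distribution" by (rule product_std_normal)
  interpret P: pair_sigma_finite std_normal_distribution normals by (rule pair_std_normal)
  let ?J = "J - {i}"
  define F where "F \<xi> = g (\<xi> i) * (\<Prod>j\<in>?J. f j (\<xi> i) (\<xi> j))" for \<xi>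
  have ins: "insert i ?J = J" "{i} \<union> ?J = J" "{i} \<inter> ?J = {}" "finite ?J" using i fin by auto
  have "(\<lambda>\<xi>. f j (\<xi> i) (\<xi> j)) \<in> borel_measurable (Pi\<^sub>M J (\<lambda>_. borel :: real measure))" if "j \<in> ?J" for j
    using measurable_compose[OF measurable_Pair[OF component_measurable[of i] component_measurable[of j]] f[OF that]] i that by simp
  hence m: "F \<in> borel_measurable (Pi\<^sub>M J (\<lambda>_. borel :: real measure))"
    unfolding F_def[abs_def] using i
    by (intro borel_measurable_times borel_measurable_prod measurable_compose[OF component_measurable g]) auto
  have b: "norm (F \<xi>) \<le> 1" for \<xi>
    unfolding F_def norm_mult prod_norm[symmetric] using g1 f1
    by (intro mult_le_one prod_le_1 prod_nonneg) auto
  have inner: "(\<integral>\<xi>. F \<xi> * mix_tilt x \<xi> \<partial>normals) = H x" for x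
  proof -
    let ?h = "\<lambda>\<xi>. F \<xi> * mix_tilt x \<xi>"
    have hi: "integrable normals ?h"
    proof (rule Bochner_Integration.integrable_bound[OF integrable_mix_tilt_section[of x]])
      have "F \<in> borel_measurable normals" using m by simp
      thus "?h \<in> borel_measurable normals"
        using integrable_mix_tilt_section[THEN borel_measurable_integrable] by (rule borel_measurable_times)
      show "AE \<xi> in normals. norm (F \<xi> * mix_tilt x \<xi>) \<le> norm (mix_tilt x \<xi>)"
        using b by (intro always_eventually) (auto simp: norm_mult mult_left_le_one_le)
    qed
    \<comment> \<open>\<open>merge\<close> takes coordinate \<open>i\<close> from \<open>u\<close>
      and the others from \<open>y\<close>; with \<open>u\<close> fixed, the integrand is again a
      product in \<open>y\<close>.\<close>
    have sec: "(\<integral>y. ?h (merge {i} ?J (u, y)) \<partial>Pi\<^sub>M ?J (\<lambda>_. std_normal_distribution))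
        = g (u i) * tilt1 i x (u i) * (\<Prod>j\<in>?J. K j (u i) x)" for u
    proof -
      have "?h (merge {i} ?J (u, y)) = g (u i) * tilt1 i x (u i) * (\<Prod>j\<in>?J. f j (u i) (y j) * tilt1 j x (y j))" for y
      proof -
        have "F (merge {i} ?J (u, y)) = g (u i) * (\<Prod>j\<in>?J. f j (u i) (y j))"
          by (auto simp: F_def merge_def intro!: prod.cong)
        moreover have "mix_tilt x (merge {i} ?J (u, y)) = tilt1 i x (u i) * (\<Prod>j\<in>?J. tilt1 j x (y j))"
          unfolding mix_tilt_def using i fin
          by (subst prod.remove[of J i]) (auto simp: merge_def intro!: prod.cong)
        ultimately show ?thesis by (simp add: prod.distrib mult_ac)
      qed
      moreover have "(\<integral>y. (\<Prod>j\<in>?J. f j (u i) (y j) * tilt1 j x (y j)) \<partial>Pi\<^sub>M ?J (\<lambda>_. std_normal_distribution))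
         = (\<Prod>j\<in>?J. CLINT y|std_normal_distribution. f j (u i) y * tilt1 j x y)"
      proof (rule product_integral_prod[OF ins(4)])
        fix j assume j: "j \<in> ?J"
        have fm: "(\<lambda>y. f j (u i) y) \<in> borel_measurable std_normal_distribution"
          using measurable_compose[OF measurable_Pair1'[of "u i" borel borel] f[OF j]] by simp
        show "integrable std_normal_distribution (\<lambda>y. f j (u i) y * tilt1 j x y)"
          using f1[OF j] fm
          by (intro Bochner_Integration.integrable_bound[OF integrable_tilt1[of j x]] always_eventually borel_measurable_times allI)
            (auto simp: norm_mult mult_left_le_one_le)
      qed
      ultimately show ?thesis using K by simp
    qed
    have "(\<integral>\<xi>. ?h \<xi> \<partial>normals) = (\<integral>u. (\<integral>y. ?h (merge {i} ?J (u, y)) \<partial>Pi\<^sub>M ?J (\<lambda>_. std_normal_distribution)) \<partial>Pi\<^sub>M {i} (\<lambda>_. std_normal_distribution))"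
      using product_integral_fold[of "{i}" ?J ?h] ins hi by simp
    also have "\<dots> = H x"
      unfolding sec H_def
      by (rule product_integral_singleton) (auto intro!: borel_measurable_times borel_measurable_prod Km)
    finally show ?thesis .
  qed
  show "integrable std_normal_distribution H"
    using P.integrable_fst'[OF mix_bounded(1)[OF m b]] by (simp add: inner)
  show "(\<integral>\<xi>. g (\<xi> i) * (\<Prod>j\<in>?J. f j (\<xi> i) (\<xi> j)) \<partial>mix) = (CLINT x|std_normal_distribution. H x)"
    using mix_bounded(2)[OF m b] unfolding inner by (simp only: F_def)
qed

lemma sets_mix [measurable_cong, simp]: "sets mix = sets (Pi\<^sub>M J (\<lambda>_. borel :: real measure))"
  by (simp add: mix_def)

section \<open>The law of the mixture\<close>

text \<open>With characters as factors, the \<open>x^2\<close> term of each coordinate integral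
  cancels the normalisation in \<open>tilt1\<close>, so the result is an exponential linear in
  \<open>x\<close>. Integrating out \<open>x\<close> squares the coefficient
  \<open>\<i> * \<theta> * (\<Sum>j\<in>J. b j)\<close>, and \<open>\<theta>^2 = 1 / c\<close> gives
  the shared covariance for either sign of \<open>c\<close>.\<close>

lemma mix_char:
  "(CLINT \<xi>|mix. cis (\<Sum>j\<in>J. b j * (\<xi> j / sqrt (lam j))))
    = exp (- ((\<Sum>j\<in>J. b j)\<^sup>2 / c + (\<Sum>j\<in>J. (b j)\<^sup>2 / lam j)) / 2)"
proof -
  let ?f = "\<lambda>j y. cis (b j * (y / sqrt (lam j)))"
  let ?K = "\<lambda>j x. exp (\<i> * \<theta> * complex_of_real (b j) * complex_of_real x - complex_of_real ((b j)\<^sup>2 / (2 * lam j)))"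
  have K: "(CLINT y|std_normal_distribution. ?f j y * tilt1 j x y) = ?K j x" if j: "j \<in> J" for j x
  proof -
    let ?s = "complex_of_real (sqrt (lam j))"
    let ?a = "\<i> * complex_of_real (b j) / ?s + \<theta> * complex_of_real x * ?s"
    have s: "?s \<noteq> 0" "?s\<^sup>2 = complex_of_real (lam j)"
      using lam_pos[OF j] by (auto simp flip: of_real_power)
    have "?f j y * tilt1 j x y = exp (?a * complex_of_real y) * exp (- complex_of_real (lam j * x\<^sup>2 / (2 * c)))" for y
      unfolding cis_conv_exp tilt1_def exp_add[symmetric] using s by (simp add: field_simps)
    hence "(CLINT y|std_normal_distribution. ?f j y * tilt1 j x y) = exp (?a\<^sup>2 / 2) * exp (- complex_of_real (lam j * x\<^sup>2 / (2 * c)))"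
      by (simp add: std_normal_tilt)
    also have "?a\<^sup>2 = - (complex_of_real ((b j)\<^sup>2)) / ?s\<^sup>2 + 2 * \<i> * \<theta> * complex_of_real (b j) * complex_of_real x + \<theta>\<^sup>2 * complex_of_real (x\<^sup>2) * ?s\<^sup>2"
      using s(1) by (simp add: power2_eq_square field_simps)
    also have "(- (complex_of_real ((b j)\<^sup>2)) / ?s\<^sup>2 + 2 * \<i> * \<theta> * complex_of_real (b j) * complex_of_real x + \<theta>\<^sup>2 * complex_of_real (x\<^sup>2) * ?s\<^sup>2) / 2
        = \<i> * \<theta> * complex_of_real (b j) * complex_of_real x - complex_of_real ((b j)\<^sup>2 / (2 * lam j)) + complex_of_real (lam j * x\<^sup>2 / (2 * c))"
      unfolding s(2) \<theta>_square by (simp add: add_divide_distrib diff_divide_distrib mult_ac)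
    finally show ?thesis by (simp add: exp_add exp_minus)
  qed
  have "(CLINT \<xi>|mix. cis (\<Sum>j\<in>J. b j * (\<xi> j / sqrt (lam j)))) = (CLINT \<xi>|mix. (\<Prod>j\<in>J. ?f j (\<xi> j)))"
    by (simp add: cis_conv_exp exp_sum[OF fin] sum_distrib_left)
  also have "\<dots> = (CLINT x|std_normal_distribution. (\<Prod>j\<in>J. ?K j x))"
    by (rule mix_prod(2)[OF _ _ K]) auto
  also have "\<dots> = (CLINT x|std_normal_distribution. exp (\<i> * \<theta> * complex_of_real (\<Sum>j\<in>J. b j) * complex_of_real x)
      * exp (- complex_of_real (\<Sum>j\<in>J. (b j)\<^sup>2 / (2 * lam j))))"
    unfolding exp_sum[OF fin, symmetric] exp_add[symmetric]
    by (simp add: sum_subtractf sum_distrib_left sum_distrib_right)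
  also have "\<dots> = exp ((\<i> * \<theta> * complex_of_real (\<Sum>j\<in>J. b j))\<^sup>2 / 2) * exp (- complex_of_real (\<Sum>j\<in>J. (b j)\<^sup>2 / (2 * lam j)))"
    by (simp add: std_normal_tilt)
  also have "\<dots> = exp (- ((\<Sum>j\<in>J. b j)\<^sup>2 / c + (\<Sum>j\<in>J. (b j)\<^sup>2 / lam j)) / 2)"
  proof -
    have half: "(\<Sum>j\<in>J. (b j)\<^sup>2 / (2 * lam j)) = (\<Sum>j\<in>J. (b j)\<^sup>2 / lam j) / 2"
      by (simp add: sum_divide_distrib mult.commute)
    show ?thesis unfolding half exp_add[symmetric] power_mult_distrib \<theta>_square exp_of_real[symmetric]
      by (intro arg_cong[where f = exp]) (simp add: add_divide_distrib diff_divide_distrib del: of_real_sum)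
  qed
  finally show ?thesis .
qed

lemma prob_space_mix: "prob_space mix"
proof
  have "(CLINT \<xi>|mix. 1) = 1"
    using mix_char[of "\<lambda>_. 0"] by simp
  hence "measure mix (space mix) = 1"
    by (simp add: scaleR_conv_of_real)
  \<comment> \<open>\<open>measure\<close> is zero at infinite mass, so the value one also shows
    that the mass is finite.\<close>
  thus "emeasure mix (space mix) = 1"
    by (cases "emeasure mix (space mix)") (auto simp: measure_def)
qed

text \<open>The factor \<open>exp (b^2 / 2)\<close> of the half-line formula cancels the
  normalisation in \<open>tilt1\<close>, leaving a bare \<open>Phi\<close>.\<close>

lemma tilt1_halfline:
  assumes "j \<in> J" "\<epsilon> \<in> {-1, 1}"
  shows "(CLINT y|std_normal_distribution. indicator {y. \<epsilon> * y \<le> t} y * tilt1 j x y)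
    = Phi (complex_of_real t - complex_of_real \<epsilon> * (\<theta> * complex_of_real (sqrt (lam j) * x)))"
proof -
  let ?b = "\<theta> * complex_of_real (sqrt (lam j) * x)"
  have "indicator {y. \<epsilon> * y \<le> t} y * tilt1 j x y
     = (indicator {y. \<epsilon> * y \<le> t} y *\<^sub>R exp (?b * complex_of_real y)) * exp (- complex_of_real (lam j * x\<^sup>2 / (2 * c)))" for y
    by (simp add: tilt1_def indicator_def exp_add[symmetric])
  hence "(CLINT y|std_normal_distribution. indicator {y. \<epsilon> * y \<le> t} y * tilt1 j x y)
     = exp (?b\<^sup>2 / 2) * Phi (complex_of_real t - complex_of_real \<epsilon> * ?b) * exp (- complex_of_real (lam j * x\<^sup>2 / (2 * c)))"
    by (simp only: integral_mult_left_zero std_normal_tilt_halfline[OF assms(2)])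
  also have "?b\<^sup>2 / 2 = complex_of_real (lam j * x\<^sup>2 / (2 * c))"
  proof -
    have "(complex_of_real (sqrt (lam j) * x))\<^sup>2 = complex_of_real (lam j * x\<^sup>2)"
      using lam_pos[OF assms(1)] by (simp add: power_mult_distrib flip: of_real_power)
    thus ?thesis unfolding power_mult_distrib[of \<theta>] \<theta>_square by simp
  qed
  finally show ?thesis by (simp add: exp_minus)
qed

end

section \<open>Half-line probabilities and the formula centred at \<open>l 0\<close>\<close>

lemma integrable_std_normal_iff:
  fixes f :: "real \<Rightarrow> complex"
  assumes [measurable]: "f \<in> borel_measurable borel"
  shows "integrable std_normal_distribution f \<longleftrightarrow>
    integrable lborel (\<lambda>x. f x * complex_of_real (exp (- (x\<^sup>2) / 2)))"
proof -
  let ?g = "\<lambda>x. f x * complex_of_real (exp (- (x\<^sup>2) / 2))" and ?c = "complex_of_real (sqrt (2 * pi))"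
  have e: "std_normal_density x *\<^sub>R f x = 1 / ?c * ?g x" for x
    by (simp add: std_normal_density_def scaleR_conv_of_real)
  have "integrable std_normal_distribution f \<longleftrightarrow> integrable lborel (\<lambda>x. 1 / ?c * ?g x)"
    unfolding e[symmetric] by (rule integrable_density) auto
  also have "\<dots> \<longleftrightarrow> integrable lborel ?g"
  proof
    assume "integrable lborel (\<lambda>x. 1 / ?c * ?g x)"
    hence "integrable lborel (\<lambda>x. ?c * (1 / ?c * ?g x))" by (rule integrable_mult_right)
    thus "integrable lborel ?g" by simp
  qed (rule integrable_mult_right)
  finally show ?thesis .
qed

lemma integral_std_normal:
  fixes f :: "real \<Rightarrow> complex"
  assumes [measurable]: "f \<in> borel_measurable borel"
  shows "(CLINT x|std_normal_distribution. f x)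
    = 1 / complex_of_real (sqrt (2 * pi)) * (LBINT x. f x * complex_of_real (exp (- (x\<^sup>2) / 2)))"
proof -
  have "(CLINT x|std_normal_distribution. f x) = (LBINT x. std_normal_density x *\<^sub>R f x)"
    by (subst integral_density) auto
  also have "\<dots> = (LBINT x. 1 / complex_of_real (sqrt (2 * pi)) * (f x * complex_of_real (exp (- (x\<^sup>2) / 2))))"
    by (intro Bochner_Integration.integral_cong) (simp_all add: std_normal_density_def scaleR_conv_of_real)
  finally show ?thesis by (simp only: integral_mult_right_zero)
qed

lemma prod_indicator_expectation:
  assumes "finite I" "prob_space M"
  shows "(CLINT x|M. indicator A x * (\<Prod>i\<in>I. indicator (B i) x)) = complex_of_real (\<P>(x in M. x \<in> A \<and> (\<forall>i\<in>I. x \<in> B i)))"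
proof -
  have "indicator A x * (\<Prod>i\<in>I. indicator (B i) x) = (complex_of_real (indicator {x \<in> space M. x \<in> A \<and> (\<forall>i\<in>I. x \<in> B i)} x))"
    if "x \<in> space M" for x
    using that assms(1) by (auto simp: indicator_def)
  hence "(CLINT x|M. indicator A x * (\<Prod>i\<in>I. indicator (B i) x))
      = (CLINT x|M. complex_of_real (indicator {x \<in> space M. x \<in> A \<and> (\<forall>i\<in>I. x \<in> B i)} x))"
    by (intro Bochner_Integration.integral_cong) auto
  also have "\<dots> = complex_of_real (\<integral>x. indicator {x \<in> space M. x \<in> A \<and> (\<forall>i\<in>I. x \<in> B i)} x \<partial>M)"
    by (rule integral_complex_of_real)
  finally show ?thesis by (simp add: Int_absorb2 subset_eq)
qed

context gaussian_mixture
begin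

lemma component_measurable_mix: "j \<in> J \<Longrightarrow> (\<lambda>\<xi>. \<xi> j) \<in> borel_measurable mix"
  unfolding measurable_cong_sets[OF sets_mix refl] by (rule component_measurable)

lemma \<theta>_sqrt_quot: "j \<in> J \<Longrightarrow> complex_of_real (sqrt (lam j)) * \<theta> = - sqrt_quot (lam j) c"
  using lam_pos[of j] by (simp add: \<theta>_def sqrt_quot_def csqrt_of_real_nonneg)

lemma halfline_prod:
  assumes \<epsilon>: "\<And>j. j \<in> J \<Longrightarrow> \<epsilon> j \<in> {-1, 1 :: real}"
  defines "Q \<equiv> \<lambda>x. \<Prod>j\<in>J. Phi (complex_of_real (\<epsilon> j) * sqrt_quot (lam j) c * complex_of_real x)"
  shows "integrable std_normal_distribution Q"
    and "complex_of_real (\<P>(\<xi> in mix. \<forall>j\<in>J. \<epsilon> j * (\<xi> j / sqrt (lam j)) \<le> 0)) = (CLINT x|std_normal_distribution. Q x)"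
proof -
  have K: "(CLINT y|std_normal_distribution. indicator {y. \<epsilon> j * y \<le> 0} y * tilt1 j x y)
      = Phi (complex_of_real (\<epsilon> j) * sqrt_quot (lam j) c * complex_of_real x)" if "j \<in> J" for j x
  proof -
    have "complex_of_real 0 - complex_of_real (\<epsilon> j) * (\<theta> * complex_of_real (sqrt (lam j) * x))
       = - (complex_of_real (\<epsilon> j) * (complex_of_real (sqrt (lam j)) * \<theta>) * complex_of_real x)"
      by simp
    thus ?thesis using tilt1_halfline[OF that \<epsilon>[OF that], of 0 x] \<theta>_sqrt_quot[OF that] by simp
  qed
  note p = mix_prod[where f = "\<lambda>j. indicator {y. \<epsilon> j * y \<le> 0}", OF _ _ K]
  have m: "(indicator {y. \<epsilon> j * y \<le> 0} :: real \<Rightarrow> complex) \<in> borel_measurable borel" for j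
    by measurable
  show "integrable std_normal_distribution Q"
    unfolding Q_def by (rule p(1)) (auto simp: m indicator_def)
  have "(CLINT x|std_normal_distribution. Q x) = (CLINT \<xi>|mix. (\<Prod>j\<in>J. indicator {y. \<epsilon> j * y \<le> 0} (\<xi> j)))"
    unfolding Q_def by (rule p(2)[symmetric]) (auto simp: m indicator_def)
  also have "\<dots> = (CLINT \<xi>|mix. indicator UNIV \<xi> * (\<Prod>j\<in>J. indicator {\<xi>. \<epsilon> j * (\<xi> j / sqrt (lam j)) \<le> 0} \<xi>))"
  proof (intro Bochner_Integration.integral_cong refl)
    fix \<xi> :: "nat \<Rightarrow> real"
    have "\<epsilon> j * \<xi> j \<le> 0 \<longleftrightarrow> \<epsilon> j * (\<xi> j / sqrt (lam j)) \<le> 0" if "j \<in> J" for j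
      using lam_pos[OF that] by (simp add: divide_le_0_iff)
    thus "(\<Prod>j\<in>J. indicator {y. \<epsilon> j * y \<le> 0} (\<xi> j)) = (indicator UNIV \<xi> * (\<Prod>j\<in>J. indicator {\<xi>. \<epsilon> j * (\<xi> j / sqrt (lam j)) \<le> 0} \<xi>) :: complex)"
      by (auto intro!: prod.cong simp: indicator_def)
  qed
  also have "\<dots> = complex_of_real (\<P>(\<xi> in mix. \<forall>j\<in>J. \<epsilon> j * (\<xi> j / sqrt (lam j)) \<le> 0))"
    by (subst prod_indicator_expectation[OF fin prob_space_mix]) simp
  finally show "complex_of_real (\<P>(\<xi> in mix. \<forall>j\<in>J. \<epsilon> j * (\<xi> j / sqrt (lam j)) \<le> 0)) = (CLINT x|std_normal_distribution. Q x)" ..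
qed

end

lemma g_fun_central_outlier:
  fixes d :: nat and l \<epsilon> :: "nat \<Rightarrow> real"
  assumes eps: "\<forall>j\<in>{1..d}. \<epsilon> j \<in> {-1, 1}" and pos: "\<forall>j\<in>{1..d}. l j > 0"
    and l0: "l 0 > 0 \<or> l 0 < - (\<Sum>j\<in>{1..d}. l j)"
  defines "F \<equiv> \<lambda>x::real. (\<Prod>j\<in>{1..d}. Phi (complex_of_real (\<epsilon> j) * sqrt_quot (l j) (l 0) * complex_of_real x))
                 * complex_of_real (exp (- (x ^ 2) / 2))"
  shows "integrable lborel F"
    and "complex_of_real (g_fun d l \<epsilon>) = 1 / complex_of_real (sqrt (2 * pi)) * (LBINT x. F x)"
proof -
  interpret gaussian_mixture "{1..d}" l "l 0"
    by unfold_locales (use pos l0 in auto)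
  define Q where "Q = (\<lambda>x. \<Prod>j\<in>{1..d}. Phi (complex_of_real (\<epsilon> j) * sqrt_quot (l j) (l 0) * complex_of_real x))"
  have [measurable]: "Q \<in> borel_measurable borel" unfolding Q_def by measurable
  have h: "integrable std_normal_distribution Q"
    "complex_of_real (\<P>(\<xi> in mix. \<forall>j\<in>{1..d}. \<epsilon> j * (\<xi> j / sqrt (l j)) \<le> 0)) = (CLINT x|std_normal_distribution. Q x)"
    unfolding Q_def using eps by (intro halfline_prod; blast)+
  show "integrable lborel F"
    using h(1) unfolding F_def Q_def[symmetric] fun_cong[OF Q_def, symmetric] by (simp add: integrable_std_normal_iff)
  have "g_fun d l \<epsilon> = \<P>(\<xi> in mix. \<forall>j\<in>{1..d}. \<epsilon> j * (\<xi> j / sqrt (l j)) \<le> 0)"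
  \<comment> \<open>For \<open>d = 0\<close> the value one is set by definition and agrees with the
    mass of the whole space; the description by Gaussian vectors covers
    \<open>d > 0\<close>.\<close>
  proof (cases "d = 0")
    case True
    thus ?thesis using prob_space.prob_space[OF prob_space_mix] by (simp add: g_fun_def)
  next
    case False
    thus ?thesis
      by (intro g_fun_eqI prob_space_mix mix_char borel_measurable_divide component_measurable_mix) auto
  qed
  thus "complex_of_real (g_fun d l \<epsilon>) = 1 / complex_of_real (sqrt (2 * pi)) * (LBINT x. F x)"
    using h(2) integral_std_normal[of Q] unfolding F_def fun_cong[OF Q_def, symmetric] by simp
qed

section \<open>Shifting the half line\<close>

text \<open>The intended values are \<open>\<alpha> = l 0\<close>, \<open>\<mu> = - l k\<close>,
  signs \<open>\<epsilon> k * \<epsilon> j\<close>, and for \<open>J\<close> the indices other than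
  \<open>0\<close> and \<open>k\<close>; the assumption on \<open>\<mu>\<close> is then the
  negativity of the total sum.\<close>

locale shifted_halfline =
  fixes J :: "nat set" and lam \<epsilon> :: "nat \<Rightarrow> real" and \<alpha> \<mu> :: real
  assumes fin: "finite J" and lam_pos: "\<And>j. j \<in> J \<Longrightarrow> lam j > 0"
    and eps: "\<And>j. j \<in> J \<Longrightarrow> \<epsilon> j \<in> {-1, 1}"
    and \<alpha>: "\<alpha> > 0" and \<mu>: "\<mu> > \<alpha> + (\<Sum>j\<in>J. lam j)"
begin

definition P :: "complex \<Rightarrow> complex" where
  "P w = (\<Prod>j\<in>J. Phi (complex_of_real (\<epsilon> j * sqrt (lam j)) * w))"

definition h :: "complex \<Rightarrow> complex" where
  "h w = exp (- (complex_of_real \<alpha> * w\<^sup>2) / 2) * P w"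

definition H :: "real \<Rightarrow> complex" where
  "H z = (LBINT y:{0..}. h (complex_of_real y + \<i> * complex_of_real z))"

text \<open>The vertical side of the rectangle contributes the integral of
  \<open>\<i> * h (\<i> * t)\<close>, whose real part is \<open>- k t\<close>.\<close>

definition k :: "real \<Rightarrow> real" where "k t = Im (h (\<i> * complex_of_real t))"

lemma h_holomorphic: "h holomorphic_on UNIV"
proof -
  have "(\<lambda>w. Phi (complex_of_real (\<epsilon> j * sqrt (lam j)) * w)) holomorphic_on UNIV" for j
    using holomorphic_on_compose[OF _ Phi_holomorphic, of "\<lambda>w. complex_of_real (\<epsilon> j * sqrt (lam j)) * w" UNIV]
    by (simp add: o_def holomorphic_intros)
  thus ?thesis unfolding h_def[abs_def] P_def by (intro holomorphic_intros) auto
qed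

lemma continuous_on_h [continuous_intros]: "continuous_on S f \<Longrightarrow> continuous_on S (\<lambda>x. h (f x))"
  using continuous_on_compose2[OF holomorphic_on_imp_continuous_on[OF h_holomorphic]] by blast

lemma h_measurable [measurable]: "h \<in> borel_measurable borel"
  by (intro borel_measurable_continuous_onI continuous_on_h continuous_on_id)

lemma h_cnj: "h (cnj w) = cnj (h w)"
  by (simp add: h_def P_def exp_cnj Phi_cnj[symmetric])

text \<open>\<open>norm_Phi_le\<close> bounds each factor by a Gaussian in \<open>Im w\<close>; the
  exponents add up to \<open>\<alpha> + (\<Sum>j\<in>J. lam j)\<close>, which lies below
  \<open>\<mu>\<close>. The decay in \<open>Re w\<close> gives integrability on horizontal rays and
  makes the far side of the rectangle negligible.\<close>

lemma norm_h_le: "norm (h w) \<le> exp (\<mu> * (Im w)\<^sup>2 / 2) * exp (- (\<alpha> * (Re w)\<^sup>2) / 2)"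
proof -
  have "norm (P w) \<le> (\<Prod>j\<in>J. exp (lam j * (Im w)\<^sup>2 / 2))"
    unfolding P_def prod_norm[symmetric]
  proof (intro prod_mono conjI norm_ge_zero)
    fix j assume j: "j \<in> J"
    have "(Im (complex_of_real (\<epsilon> j * sqrt (lam j)) * w))\<^sup>2 = lam j * (Im w)\<^sup>2"
      using eps[OF j] lam_pos[OF j] by (auto simp: power_mult_distrib)
    thus "norm (Phi (complex_of_real (\<epsilon> j * sqrt (lam j)) * w)) \<le> exp (lam j * (Im w)\<^sup>2 / 2)"
      using norm_Phi_le[of "complex_of_real (\<epsilon> j * sqrt (lam j)) * w"] by (simp only:)
  qed
  also have "\<dots> = exp ((\<Sum>j\<in>J. lam j) * (Im w)\<^sup>2 / 2)"
    by (simp add: exp_sum[OF fin, symmetric] sum_distrib_right sum_divide_distrib)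
  finally have "norm (h w) \<le> exp (Re (- (complex_of_real \<alpha> * w\<^sup>2) / 2)) * exp ((\<Sum>j\<in>J. lam j) * (Im w)\<^sup>2 / 2)"
    unfolding h_def norm_mult norm_exp_eq_Re by (intro mult_left_mono) auto
  also have "\<dots> = exp ((\<alpha> + (\<Sum>j\<in>J. lam j)) * (Im w)\<^sup>2 / 2) * exp (- (\<alpha> * (Re w)\<^sup>2) / 2)"
    unfolding exp_add[symmetric] by (simp add: power2_eq_square field_simps)
  also have "\<dots> \<le> exp (\<mu> * (Im w)\<^sup>2 / 2) * exp (- (\<alpha> * (Re w)\<^sup>2) / 2)"
    using \<mu> by (intro mult_right_mono) (auto intro: mult_right_mono)
  finally show ?thesis .
qed

lemma set_integrable_h_shift: "set_integrable lborel {0..} (\<lambda>y. h (complex_of_real y + \<i> * complex_of_real z))"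
proof -
  have "integrable lborel (\<lambda>y. h (complex_of_real y + \<i> * complex_of_real z))"
  proof (rule Bochner_Integration.integrable_bound)
    define \<sigma> where "\<sigma> = 1 / sqrt \<alpha>"
    have s: "\<sigma> > 0" "\<sigma>\<^sup>2 = 1 / \<alpha>" using \<alpha> by (auto simp: \<sigma>_def power_divide)
    show "integrable lborel (\<lambda>y. exp (\<mu> * z\<^sup>2 / 2) * sqrt (2 * pi * \<sigma>\<^sup>2) * normal_density 0 \<sigma> y)"
      using s by simp
    have "exp (\<mu> * z\<^sup>2 / 2) * sqrt (2 * pi * \<sigma>\<^sup>2) * normal_density 0 \<sigma> y = exp (\<mu> * z\<^sup>2 / 2) * exp (- (\<alpha> * y\<^sup>2) / 2)" for y
      using s \<alpha> by (simp add: normal_density_def)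
    moreover have "norm (h (complex_of_real y + \<i> * complex_of_real z)) \<le> exp (\<mu> * z\<^sup>2 / 2) * exp (- (\<alpha> * y\<^sup>2) / 2)" for y
      using norm_h_le[of "complex_of_real y + \<i> * complex_of_real z"] by simp
    ultimately have "norm (h (complex_of_real y + \<i> * complex_of_real z))
        \<le> norm (exp (\<mu> * z\<^sup>2 / 2) * sqrt (2 * pi * \<sigma>\<^sup>2) * normal_density 0 \<sigma> y)" for y
      by (simp only: real_norm_def abs_mult abs_exp_cancel)
    thus "AE y in lborel. norm (h (complex_of_real y + \<i> * complex_of_real z))
        \<le> norm (exp (\<mu> * z\<^sup>2 / 2) * sqrt (2 * pi * \<sigma>\<^sup>2) * normal_density 0 \<sigma> y)"
      by simp
  qed measurable
  thus ?thesis unfolding set_integrable_def by (intro integrable_mult_indicator) auto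
qed

text \<open>All parameters are real, so \<open>h\<close> commutes with conjugation. Consequently
  \<open>Re (H z)\<close> is even in \<open>z\<close> and \<open>H 0\<close> is real.\<close>

lemma H_minus: "H (- z) = cnj (H z)"
proof -
  have "H (- z) = (LBINT y:{0..}. cnj (h (complex_of_real y + \<i> * complex_of_real z)))"
    unfolding H_def h_cnj[symmetric] by simp
  also have "\<dots> = (LBINT y. cnj (indicator {0..} y *\<^sub>R h (complex_of_real y + \<i> * complex_of_real z)))"
    unfolding set_lebesgue_integral_def by simp
  also have "\<dots> = cnj (H z)"
    unfolding H_def set_lebesgue_integral_def by (rule Bochner_Integration.integral_cnj)
  finally show ?thesis .
qed

lemma Re_H_abs: "Re (H \<bar>z\<bar>) = Re (H z)"
  using H_minus[of z] by (auto simp: abs_if)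

text \<open>The rectangle with vertices \<open>0\<close>, \<open>R\<close>, \<open>R + \<i> z\<close>, \<open>\<i> z\<close>, where \<open>R\<close> tends to infinity; a primitive
  of the entire function \<open>h\<close> replaces Cauchy's theorem.\<close>

lemma H_shift:
  assumes z: "z \<ge> 0"
  shows "Re (H z) = Re (H 0) + (LBINT t:{0..z}. k t)"
proof -
  obtain p where p: "\<And>w. (p has_field_derivative h w) (at w)"
    using holomorphic_convex_primitive'[OF _ _ h_holomorphic] by auto
  have horiz: "(LBINT y:{0..R}. h (complex_of_real y + \<i> * complex_of_real v)) = p (complex_of_real R + \<i> * complex_of_real v) - p (\<i> * complex_of_real v)"
    if "R \<ge> 0" for R v
  proof -
    have "(LBINT y:{0..R}. h (complex_of_real y + \<i> * complex_of_real v)) = p (complex_of_real R + \<i> * complex_of_real v) - p (complex_of_real 0 + \<i> * complex_of_real v)"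
      unfolding set_lebesgue_integral_def
    proof (rule integral_FTC_atLeastAtMost[OF that])
      fix x
      have "((\<lambda>w. p (w + \<i> * complex_of_real v)) has_field_derivative h (complex_of_real x + \<i> * complex_of_real v)) (at (complex_of_real x))"
      proof -
        have "((\<lambda>w. w + \<i> * complex_of_real v) has_field_derivative 1) (at (complex_of_real x))"
          by (auto intro!: derivative_eq_intros)
        from DERIV_chain'[OF this p] show ?thesis by simp
      qed
      thus "((\<lambda>x. p (complex_of_real x + \<i> * complex_of_real v)) has_vector_derivative h (complex_of_real x + \<i> * complex_of_real v)) (at x within {0..R})"
        by (rule has_vector_derivative_real_field)
    qed (intro continuous_intros)
    thus ?thesis by simp
  qed
  have vert: "(LBINT t:{0..z}. \<i> * h (\<i> * complex_of_real t)) = p (\<i> * complex_of_real z) - p 0"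
  proof -
    have "(LBINT t:{0..z}. \<i> * h (\<i> * complex_of_real t)) = p (\<i> * complex_of_real z) - p (\<i> * complex_of_real 0)"
      unfolding set_lebesgue_integral_def
    proof (rule integral_FTC_atLeastAtMost[OF z])
      fix x
      have "((\<lambda>w. p (\<i> * w)) has_field_derivative \<i> * h (\<i> * complex_of_real x)) (at (complex_of_real x))"
      proof -
        have "((\<lambda>w. \<i> * w) has_field_derivative \<i>) (at (complex_of_real x))"
          by (auto intro!: derivative_eq_intros)
        from DERIV_chain'[OF this p] show ?thesis by (simp add: mult.commute)
      qed
      thus "((\<lambda>x. p (\<i> * complex_of_real x)) has_vector_derivative \<i> * h (\<i> * complex_of_real x)) (at x within {0..z})"
        by (rule has_vector_derivative_real_field)
    qed (intro continuous_intros)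
    thus ?thesis by simp
  qed
  \<comment> \<open>On the far side \<open>Re w = R\<close> throughout, so the Gaussian decay in
    \<open>R\<close> beats the fixed length \<open>z\<close>.\<close>
  have edge: "norm (p (complex_of_real R + \<i> * complex_of_real z) - p (complex_of_real R)) \<le> exp (\<mu> * z\<^sup>2 / 2) * exp (- (\<alpha> * R\<^sup>2) / 2) * z" for R
  proof -
    let ?S = "closed_segment (complex_of_real R) (complex_of_real R + \<i> * complex_of_real z)"
    have "norm (p (complex_of_real R + \<i> * complex_of_real z) - p (complex_of_real R))
      \<le> exp (\<mu> * z\<^sup>2 / 2) * exp (- (\<alpha> * R\<^sup>2) / 2) * norm ((complex_of_real R + \<i> * complex_of_real z) - complex_of_real R)"
    proof (rule field_differentiable_bound[where S = ?S and f = p])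
      fix w assume "w \<in> ?S"
      then obtain s where s: "0 \<le> s" "s \<le> 1" "w = (1 - s) *\<^sub>R complex_of_real R + s *\<^sub>R (complex_of_real R + \<i> * complex_of_real z)"
        by (auto simp: in_segment)
      have w: "Re w = R" "Im w = s * z" using s by (auto simp: algebra_simps)
      have "(s * z)\<^sup>2 \<le> 1\<^sup>2 * z\<^sup>2"
        unfolding power_mult_distrib using s by (intro mult_right_mono power_mono) auto
      moreover have "\<mu> > 0"
        using \<mu> \<alpha> sum_nonneg[of J lam] lam_pos by (smt (verit))
      ultimately have "exp (\<mu> * (s * z)\<^sup>2 / 2) \<le> exp (\<mu> * z\<^sup>2 / 2)"
        by (simp add: mult_left_mono)
      hence "exp (\<mu> * (s * z)\<^sup>2 / 2) * exp (- (\<alpha> * R\<^sup>2) / 2) \<le> exp (\<mu> * z\<^sup>2 / 2) * exp (- (\<alpha> * R\<^sup>2) / 2)"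
        by (intro mult_right_mono) auto
      thus "norm (h w) \<le> exp (\<mu> * z\<^sup>2 / 2) * exp (- (\<alpha> * R\<^sup>2) / 2)"
        using norm_h_le[of w] unfolding w by linarith
      show "(p has_field_derivative h w) (at w within ?S)"
        by (rule has_field_derivative_at_within[OF p])
    qed auto
    thus ?thesis using z by (simp add: norm_mult)
  qed
  let ?e = "\<lambda>R. p (complex_of_real R + \<i> * complex_of_real z) - p (complex_of_real R)"
  have lim: "((\<lambda>R. LBINT y:{0..R}. h (complex_of_real y + \<i> * complex_of_real v)) \<longlongrightarrow> H v) at_top" for v
    unfolding H_def by (intro tendsto_set_lebesgue_integral_at_top set_integrable_h_shift) auto
  have "((\<lambda>R. (LBINT y:{0..R}. h (complex_of_real y + \<i> * complex_of_real z))
      - (LBINT y:{0..R}. h (complex_of_real y + \<i> * complex_of_real 0))) \<longlongrightarrow> H z - H 0) at_top"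
    by (intro tendsto_diff lim)
  moreover have "\<forall>\<^sub>F R in at_top. (LBINT y:{0..R}. h (complex_of_real y + \<i> * complex_of_real z))
      - (LBINT y:{0..R}. h (complex_of_real y + \<i> * complex_of_real 0)) = ?e R - (p (\<i> * complex_of_real z) - p 0)"
    using eventually_ge_at_top[of "0::real"] by eventually_elim (simp only: horiz, simp)
  ultimately have "((\<lambda>R. ?e R - (p (\<i> * complex_of_real z) - p 0)) \<longlongrightarrow> H z - H 0) at_top"
    by (rule Lim_transform_eventually)
  moreover have "(?e \<longlongrightarrow> 0) at_top"
  proof (rule Lim_null_comparison)
    show "\<forall>\<^sub>F R in at_top. norm (?e R) \<le> exp (\<mu> * z\<^sup>2 / 2) * exp (- (\<alpha> * R\<^sup>2) / 2) * z"
      by (intro always_eventually allI edge)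
    show "((\<lambda>R. exp (\<mu> * z\<^sup>2 / 2) * exp (- (\<alpha> * R\<^sup>2) / 2) * z) \<longlongrightarrow> 0) at_top"
      using \<alpha> by real_asymp
  qed
  hence "((\<lambda>R. ?e R - (p (\<i> * complex_of_real z) - p 0)) \<longlongrightarrow> 0 - (p (\<i> * complex_of_real z) - p 0)) at_top"
    by (intro tendsto_diff tendsto_const)
  ultimately have "H z - H 0 = 0 - (p (\<i> * complex_of_real z) - p 0)"
    by (rule tendsto_unique[rotated]) simp
  hence "H z - H 0 = - (LBINT t:{0..z}. \<i> * h (\<i> * complex_of_real t))"
    unfolding vert by simp
  moreover have "Re (LBINT t:{0..z}. \<i> * h (\<i> * complex_of_real t)) = - (LBINT t:{0..z}. k t)"
  proof -
    have "set_integrable lborel {0..z} (\<lambda>t. \<i> * h (\<i> * complex_of_real t))"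
      by (intro borel_integrable_atLeastAtMost' continuous_intros)
    hence "Re (LBINT t:{0..z}. \<i> * h (\<i> * complex_of_real t)) = (LBINT t:{0..z}. Re (\<i> * h (\<i> * complex_of_real t)))"
      unfolding set_lebesgue_integral_def set_integrable_def by (subst integral_Re[symmetric]) auto
    also have "\<dots> = - (LBINT t:{0..z}. k t)"
      unfolding set_lebesgue_integral_def k_def by simp
    finally show ?thesis .
  qed
  ultimately show ?thesis
    by (metis add_diff_cancel_left' add.commute diff_minus_eq_add minus_complex.simps(1) uminus_complex.simps(1) minus_minus diff_add_cancel)
qed

lemma k_eq: "k t = exp (\<alpha> * t\<^sup>2 / 2) * Im (P (\<i> * complex_of_real t))"
proof -
  have "exp (- (complex_of_real \<alpha> * (\<i> * complex_of_real t)\<^sup>2) / 2) = complex_of_real (exp (\<alpha> * t\<^sup>2 / 2))"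
    by (simp add: power_mult_distrib exp_of_real[symmetric] del: exp_of_real)
  thus ?thesis by (simp add: k_def h_def)
qed

lemma P_measurable [measurable]: "P \<in> borel_measurable borel"
  unfolding P_def[abs_def] by measurable

lemma k_measurable [measurable]: "k \<in> borel_measurable borel"
  unfolding k_def[abs_def] by measurable

text \<open>By the exponential bound on the tail it suffices to integrate
  \<open>exp (- (\<mu> - \<alpha>) * t\<^sup>2 / 2) * P (\<i> * t)\<close>, which is a rescaled integrand of part (i) with
  \<open>- (\<mu> - \<alpha>)\<close> in place of \<open>l 0\<close>.\<close>

lemma set_integrable_k_tail:
  "set_integrable lborel {0..} (\<lambda>t. k t * measure std_normal_distribution {..- (sqrt \<mu> * t)})"
proof -
  define \<nu> where "\<nu> = \<mu> - \<alpha>"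
  have \<nu>: "\<nu> > (\<Sum>j\<in>J. lam j)" "\<nu> > 0"
  proof -
    show "\<nu> > (\<Sum>j\<in>J. lam j)" using \<mu> by (simp add: \<nu>_def)
    moreover have "(\<Sum>j\<in>J. lam j) \<ge> 0" using lam_pos by (intro sum_nonneg) (auto intro: less_imp_le)
    ultimately show "\<nu> > 0" by linarith
  qed
  have i: "integrable lborel (\<lambda>t. P (\<i> * complex_of_real t) * complex_of_real (exp (- ((0 + sqrt \<nu> * t)\<^sup>2) / 2)))"
  proof -
    interpret G: gaussian_mixture J lam "- \<nu>"
      by unfold_locales (use fin lam_pos \<nu> in auto)
    \<comment> \<open>Since \<open>1 / \<i> = - \<i>\<close>, the signs are reversed so that
      dividing by \<open>csqrt (- \<nu>)\<close> yields the arguments of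
      \<open>P (\<i> * t)\<close>.\<close>
    let ?Q = "\<lambda>x. \<Prod>j\<in>J. Phi (complex_of_real (- \<epsilon> j) * sqrt_quot (lam j) (- \<nu>) * complex_of_real x)"
    have "- \<epsilon> j \<in> {-1, 1}" if "j \<in> J" for j using eps[OF that] by auto
    hence "integrable std_normal_distribution ?Q"
      by (rule G.halfline_prod(1))
    hence "integrable lborel (\<lambda>x. ?Q x * complex_of_real (exp (- (x\<^sup>2) / 2)))"
      by (subst (asm) integrable_std_normal_iff) auto
    hence "integrable lborel (\<lambda>t. ?Q (0 + sqrt \<nu> * t) * complex_of_real (exp (- ((0 + sqrt \<nu> * t)\<^sup>2) / 2)))"
      using \<nu> by (intro lborel_integrable_real_affine[where t = 0 and c = "sqrt \<nu>"]) auto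
    moreover have "?Q (0 + sqrt \<nu> * t) = P (\<i> * complex_of_real t)" for t
    proof -
      have "complex_of_real (- \<epsilon> j) * sqrt_quot (lam j) (- \<nu>) * complex_of_real (0 + sqrt \<nu> * t)
         = complex_of_real (\<epsilon> j * sqrt (lam j)) * (\<i> * complex_of_real t)" if "j \<in> J" for j
      proof -
        have c1: "csqrt (complex_of_real (lam j)) = complex_of_real (sqrt (lam j))"
          using lam_pos[OF that] by (simp add: csqrt_of_real_nonneg)
        have c2: "csqrt (complex_of_real (- \<nu>)) = \<i> * complex_of_real (sqrt \<nu>)"
          using \<nu> csqrt_of_real_nonpos[of "- \<nu>"] by simp
        show ?thesis using \<nu>(2) unfolding sqrt_quot_def c1 c2 by (simp add: divide_simps)
      qed
      thus ?thesis by (simp add: P_def)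
    qed
    ultimately show ?thesis by simp
  qed
  show ?thesis unfolding set_integrable_def
  proof (rule Bochner_Integration.integrable_bound[OF i])
    have m: "measure std_normal_distribution {..- (sqrt \<mu> * t)} = Re (Phi (complex_of_real (- (sqrt \<mu> * t))))" for t
      unfolding Phi_of_real by simp
    show "(\<lambda>t. indicat_real {0..} t *\<^sub>R (k t * measure std_normal_distribution {..- (sqrt \<mu> * t)})) \<in> borel_measurable lborel"
      unfolding m by measurable
    have "norm (indicat_real {0..} t *\<^sub>R (k t * measure std_normal_distribution {..- (sqrt \<mu> * t)}))
       \<le> norm (P (\<i> * complex_of_real t) * complex_of_real (exp (- ((0 + sqrt \<nu> * t)\<^sup>2) / 2)))" for t
    proof (cases "t \<ge> 0")
      case False
      thus ?thesis by simp
    next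
      case True
      have mu0: "\<mu> \<ge> 0" using \<nu> \<alpha> by (simp add: \<nu>_def)
      have "measure std_normal_distribution {..- (sqrt \<mu> * t)} \<le> exp (- ((sqrt \<mu> * t)\<^sup>2) / 2)"
        using norm_Phi_minus_le[of "sqrt \<mu> * t"] True mu0 unfolding Phi_of_real by simp
      moreover have "\<bar>k t\<bar> \<le> exp (\<alpha> * t\<^sup>2 / 2) * norm (P (\<i> * complex_of_real t))"
        unfolding k_eq abs_mult using abs_Im_le_cmod[of "P (\<i> * complex_of_real t)"] by (simp add: mult_left_mono)
      ultimately have "\<bar>k t\<bar> * measure std_normal_distribution {..- (sqrt \<mu> * t)}
          \<le> exp (\<alpha> * t\<^sup>2 / 2) * norm (P (\<i> * complex_of_real t)) * exp (- ((sqrt \<mu> * t)\<^sup>2) / 2)"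
        by (intro mult_mono) auto
      also have "\<dots> = norm (P (\<i> * complex_of_real t)) * (exp (\<alpha> * t\<^sup>2 / 2) * exp (- ((sqrt \<mu> * t)\<^sup>2) / 2))"
        by simp
      also have "exp (\<alpha> * t\<^sup>2 / 2) * exp (- ((sqrt \<mu> * t)\<^sup>2) / 2) = exp (- ((0 + sqrt \<nu> * t)\<^sup>2) / 2)"
        unfolding exp_add[symmetric] using mu0 \<nu>(2) by (simp add: power_mult_distrib \<nu>_def field_simps)
      finally show ?thesis using True by (simp add: norm_mult abs_mult)
    qed
    thus "AE t in lborel. norm (indicat_real {0..} t *\<^sub>R (k t * measure std_normal_distribution {..- (sqrt \<mu> * t)}))
       \<le> norm (P (\<i> * complex_of_real t) * complex_of_real (exp (- ((0 + sqrt \<nu> * t)\<^sup>2) / 2)))" by simp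
  qed
qed

text \<open>For \<open>x \<ge> 0\<close> the shift formula gives the difference to
  \<open>H 0\<close> as the integral of \<open>k\<close> over \<open>[0, x / sqrt \<mu>]\<close>.
  Exchanging integrals leaves, for each \<open>t\<close>, the probability of
  \<open>x \<ge> sqrt \<mu> * t\<close>, which reflection turns into a lower tail. The factor two
  comes from evenness in \<open>x\<close>.\<close>

lemma expectation_Re_H:
  assumes i: "integrable std_normal_distribution (\<lambda>x. Re (H (x / sqrt \<mu>)))"
  shows "(\<integral>x. Re (H (x / sqrt \<mu>)) \<partial>std_normal_distribution)
    = Re (H 0) + 2 * (LBINT t:{0..}. k t * measure std_normal_distribution {..- (sqrt \<mu> * t)})"
proof -
  let ?N = std_normal_distribution
  interpret N: prob_space ?N by (rule prob_std_normal)
  interpret PS: pair_sigma_finite lborel ?N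
    by (intro pair_sigma_finite.intro N.sigma_finite_measure lborel.sigma_finite_measure_axioms prob_space_imp_sigma_finite prob_std_normal)
  have mu0: "\<mu> > 0"
    using \<mu> \<alpha> sum_nonneg[of J lam] lam_pos by (smt (verit))
  define D where "D x = Re (H (x / sqrt \<mu>)) - Re (H 0)" for x
  have Di: "integrable ?N D" unfolding D_def[abs_def] using i by simp
  have Dm [measurable]: "D \<in> borel_measurable borel" using borel_measurable_integrable[OF Di] by simp
  have Deven: "D (- x) = D x" for x
    using H_minus[of "x / sqrt \<mu>"] by (simp add: D_def)
  \<comment> \<open>The upper limit \<open>x / sqrt \<mu>\<close> is recoded as an indicator in
    \<open>(t, x)\<close>, ready for Fubini; for \<open>x < 0\<close> no \<open>t \<ge> 0\<close>
    satisfies it.\<close>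
  have Dpos: "indicator {0..} x * D x = (LBINT t. indicator {0..} t * indicator {sqrt \<mu> * t..} x * k t)" for x
  proof (cases "x \<ge> 0")
    case True
    hence "D x = (LBINT t:{0..x / sqrt \<mu>}. k t)"
      using H_shift[of "x / sqrt \<mu>"] mu0 by (simp add: D_def)
    also have "\<dots> = (LBINT t. indicator {0..} t * indicator {sqrt \<mu> * t..} x * k t)"
      unfolding set_lebesgue_integral_def using mu0
      by (intro Bochner_Integration.integral_cong) (auto simp: indicator_def field_simps)
    finally show ?thesis using True by simp
  next
    case False
    have z: "indicator {0..} t * indicator {sqrt \<mu> * t..} x * k t = 0" for t
    proof (cases "t \<ge> 0")
      case True
      hence "0 \<le> sqrt \<mu> * t" using mu0 by simp
      hence "x \<notin> {sqrt \<mu> * t..}" using False by auto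
      thus ?thesis by simp
    qed simp
    have "(LBINT t. indicator {0..} t * indicator {sqrt \<mu> * t..} x * k t) = 0"
      unfolding z by simp
    thus ?thesis using False by simp
  qed
  have tail: "(\<integral>x. indicator {sqrt \<mu> * t..} x \<partial>?N) = measure ?N {..- (sqrt \<mu> * t)}" for t
  proof -
    have "(\<integral>x. indicat_real {sqrt \<mu> * t..} x \<partial>?N) = (\<integral>x. indicat_real {sqrt \<mu> * t..} (- x) \<partial>?N)"
      by (rule std_normal_reflect[where f = "indicator {sqrt \<mu> * t..} :: real \<Rightarrow> real", symmetric]) measurable
    also have "\<dots> = (\<integral>x. indicator {..- (sqrt \<mu> * t)} x \<partial>?N)"
      by (intro Bochner_Integration.integral_cong) (auto simp: indicator_def)
    finally show ?thesis by simp
  qed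
  have int: "integrable (lborel \<Otimes>\<^sub>M ?N) (\<lambda>(t, x). indicator {0..} t * indicator {sqrt \<mu> * t..} x * k t)"
  proof (rule PS.Fubini_integrable)
    have "{z :: real \<times> real. sqrt \<mu> * fst z \<le> snd z} \<in> sets (borel \<Otimes>\<^sub>M borel)"
      unfolding borel_prod by (intro borel_closed closed_Collect_le continuous_intros)
    hence "(\<lambda>z :: real \<times> real. indicator {z. sqrt \<mu> * fst z \<le> snd z} z :: real) \<in> borel_measurable (borel \<Otimes>\<^sub>M borel)" by measurable
    hence "(\<lambda>z :: real \<times> real. indicator {0..} (fst z) * indicator {z. sqrt \<mu> * fst z \<le> snd z} z * k (fst z)) \<in> borel_measurable (borel \<Otimes>\<^sub>M borel)"
      by measurable
    moreover have "(\<lambda>(t, x). indicator {0..} t * indicator {sqrt \<mu> * t..} x * k t) = (\<lambda>z :: real \<times> real. indicator {0..} (fst z) * indicator {z. sqrt \<mu> * fst z \<le> snd z} z * k (fst z))"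
      by (auto simp: indicator_def fun_eq_iff)
    moreover have "sets (lborel \<Otimes>\<^sub>M ?N) = sets (borel \<Otimes>\<^sub>M borel :: (real \<times> real) measure)"
      by (intro sets_pair_measure_cong) auto
    ultimately show "(\<lambda>(t, x). indicator {0..} t * indicator {sqrt \<mu> * t..} x * k t) \<in> borel_measurable (lborel \<Otimes>\<^sub>M ?N)"
      by (simp cong: measurable_cong_sets)
    have "(\<integral>x. norm (indicator {0..} t * indicator {sqrt \<mu> * t..} x * k t) \<partial>?N)
        = \<bar>indicator {0..} t * (k t * measure ?N {..- (sqrt \<mu> * t)})\<bar>" for t
    proof -
      have "norm (indicator {0..} t * indicator {sqrt \<mu> * t..} x * k t) = indicator {0..} t * \<bar>k t\<bar> * indicator {sqrt \<mu> * t..} x" for x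
        by (auto simp: indicator_def)
      hence "(\<integral>x. norm (indicator {0..} t * indicator {sqrt \<mu> * t..} x * k t) \<partial>?N) = indicator {0..} t * \<bar>k t\<bar> * measure ?N {..- (sqrt \<mu> * t)}"
        by (simp only: integral_mult_right_zero tail)
      thus ?thesis by (simp add: abs_mult)
    qed
    thus "integrable lborel (\<lambda>t. \<integral>x. norm (case (t, x) of (t, x) \<Rightarrow> indicator {0..} t * indicator {sqrt \<mu> * t..} x * k t) \<partial>?N)"
      using set_integrable_k_tail[unfolded set_integrable_def, THEN integrable_norm] by simp
    show "AE t in lborel. integrable ?N (\<lambda>x. case (t, x) of (t, x) \<Rightarrow> indicator {0..} t * indicator {sqrt \<mu> * t..} x * k t)"
    proof (intro always_eventually allI)
      fix t
      have "integrable ?N (\<lambda>x. (indicator {0..} t * k t) * indicator {sqrt \<mu> * t..} x)"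
        by (intro integrable_mult_right N.integrable_const_bound[where B = 1]) (auto simp: indicator_def)
      thus "integrable ?N (\<lambda>x. case (t, x) of (t, x) \<Rightarrow> indicator {0..} t * indicator {sqrt \<mu> * t..} x * k t)"
        by (simp add: mult_ac)
    qed
  qed
  have half: "(\<integral>x. indicator {0..} x * D x \<partial>?N) = (LBINT t:{0..}. k t * measure ?N {..- (sqrt \<mu> * t)})"
  proof -
    have "(\<integral>x. indicator {0..} x * D x \<partial>?N) = (\<integral>x. (LBINT t. indicator {0..} t * indicator {sqrt \<mu> * t..} x * k t) \<partial>?N)"
      by (simp only: Dpos)
    also have "\<dots> = (LBINT t. (\<integral>x. indicator {0..} t * indicator {sqrt \<mu> * t..} x * k t \<partial>?N))"
      using int by (rule PS.Fubini_integral)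
    also have "\<dots> = (LBINT t:{0..}. k t * measure ?N {..- (sqrt \<mu> * t)})"
      unfolding set_lebesgue_integral_def
    proof (intro Bochner_Integration.integral_cong refl)
      fix t
      have "(\<integral>x. indicator {0..} t * indicator {sqrt \<mu> * t..} x * k t \<partial>?N) = (\<integral>x. (indicator {0..} t * k t) * indicator {sqrt \<mu> * t..} x \<partial>?N)"
        by (simp only: mult_ac)
      also have "\<dots> = (indicator {0..} t * k t) * measure ?N {..- (sqrt \<mu> * t)}"
        by (simp only: integral_mult_right_zero tail)
      finally show "(\<integral>x. indicator {0..} t * indicator {sqrt \<mu> * t..} x * k t \<partial>?N) = indicator {0..} t *\<^sub>R (k t * measure ?N {..- (sqrt \<mu> * t)})"
        by simp
    qed
    finally show ?thesis .
  qed
  have "(\<integral>x. D x \<partial>?N) = (\<integral>x. indicator {0..} x * D x + indicator {0..} (- x) * D (- x) \<partial>?N)"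
  proof (intro Bochner_Integration.integral_cong refl)
    fix x :: real
    \<comment> \<open>Both half lines contain \<open>0\<close>; this value makes the double counting
      harmless.\<close>
    have "D 0 = 0" by (simp add: D_def)
    thus "D x = indicator {0..} x * D x + indicator {0..} (- x) * D (- x)"
      by (cases "x = 0") (auto simp: indicator_def Deven)
  qed
  also have "\<dots> = (\<integral>x. indicator {0..} x * D x \<partial>?N) + (\<integral>x. indicator {0..} (- x) * D (- x) \<partial>?N)"
  proof (rule Bochner_Integration.integral_add)
    show "integrable ?N (\<lambda>x. indicator {0..} x * D x)"
      using integrable_mult_indicator[OF _ Di, of "{0..}"] by simp
    have "integrable ?N (\<lambda>x. indicator {..0} x * D x)"
      using integrable_mult_indicator[OF _ Di, of "{..0}"] by simp
    moreover have "indicator {0..} (- x) * D (- x) = indicator {..0} x * D x" for x :: real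
      by (simp add: Deven indicator_def)
    ultimately show "integrable ?N (\<lambda>x. indicator {0..} (- x) * D (- x))" by simp
  qed
  also have "(\<integral>x. indicator {0..} (- x) * D (- x) \<partial>?N) = (\<integral>x. indicator {0..} x * D x \<partial>?N)"
    by (rule std_normal_reflect) measurable
  finally have "(\<integral>x. D x \<partial>?N) = 2 * (LBINT t:{0..}. k t * measure ?N {..- (sqrt \<mu> * t)})"
    unfolding half by simp
  moreover have "(\<integral>x. D x \<partial>?N) = (\<integral>x. Re (H (x / sqrt \<mu>)) \<partial>?N) - Re (H 0)"
    unfolding D_def using i N.prob_space by simp
  ultimately show ?thesis by simp
qed

end


text \<open>Here \<open>l k\<close> plays the role of the central parameter: in terms of \<open>\<xi>\<close> the vector of part (ii)
  is \<open>\<eta> k = - u 0\<close> and \<open>\<eta> j = u j - u 0\<close> for \<open>j \<noteq> k\<close>, where \<open>u j = \<xi> j / sqrt (l j)\<close>.\<close>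

lemma g_fun_noncentral_outlier:
  fixes d :: nat and l \<epsilon> :: "nat \<Rightarrow> real"
  assumes eps: "\<forall>j\<in>{1..d}. \<epsilon> j \<in> {-1, 1}" and k: "k \<in> {1..d}"
    and pos: "\<forall>i\<in>{0..d} - {k}. l i > 0" and lk: "l k < 0" and sum_neg: "(\<Sum>i\<in>{0..d}. l i) < 0"
  defines "F \<equiv> \<lambda>y::real. complex_of_real (exp (- (l 0 * y ^ 2) / 2)) *
                 (\<Prod>j\<in>{1..d} - {k}. Phi (complex_of_real (\<epsilon> k * \<epsilon> j * sqrt (l j) * y)))"
    and "G \<equiv> \<lambda>y::real. complex_of_real (exp (l 0 * y ^ 2 / 2)) *
                 Phi (complex_of_real (- (sqrt (- l k) * y))) *
                 complex_of_real (Im (\<Prod>j\<in>{1..d} - {k}. Phi (\<i> * complex_of_real (\<epsilon> k * \<epsilon> j * sqrt (l j) * y))))"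
  shows "set_integrable lborel {0..} F" "set_integrable lborel {0..} G"
    "complex_of_real (g_fun d l \<epsilon>) =
            complex_of_real (sqrt (l 0 / (2 * pi))) *
              ((LBINT y:{0..}. F y) + 2 * (LBINT y:{0..}. G y))"
proof -
  let ?N = std_normal_distribution
  define J where "J = {0..d} - {k}"
  define J' where "J' = {1..d} - {k}"
  have J: "finite J" "0 \<in> J" "J - {0} = J'" "finite J'" "0 \<notin> J'" "J = insert 0 J'" "k \<notin> J'" "{1..d} = insert k J'"
    using k by (auto simp: J_def J'_def)
  have lpos: "l j > 0" if "j \<in> J" for j using pos that by (auto simp: J_def)
  have l0: "l 0 > 0" using lpos J by auto
  have ej: "\<epsilon> j \<in> {-1, 1}" if "j \<in> J'" for j
    using eps that by (auto simp: J'_def)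
  have ek: "\<epsilon> k \<in> {-1, 1}" using eps k by auto
  have ek2: "\<epsilon> k * \<epsilon> k = 1" "\<epsilon> k \<noteq> 0" "\<bar>\<epsilon> k\<bar> = 1" using ek by auto
  have S: "(\<Sum>j\<in>J. l j) < - l k"
    using sum_neg sum.remove[of "{0..d}" k l] k by (simp add: J_def)
  have S': "(\<Sum>j\<in>J. l j) = l 0 + (\<Sum>j\<in>J'. l j)" using J by simp
  interpret gaussian_mixture J l "l k"
    by unfold_locales (use J lpos S in auto)
  \<comment> \<open>The factor \<open>\<epsilon> k\<close> anticipates the substitution that turns
    the half line of coordinate \<open>0\<close> into the positive one.\<close>
  interpret sh: shifted_halfline J' l "\<lambda>j. \<epsilon> k * \<epsilon> j" "l 0" "- l k"
  proof unfold_locales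
    show "\<epsilon> k * \<epsilon> j \<in> {-1, 1}" if "j \<in> J'" for j using ej[OF that] ek by auto
  qed (use J lpos S S' in auto)
  define m where "m = sqrt (- l k)"
  have m: "m > 0" using lk by (simp add: m_def)

  have F: "F y = sh.h (complex_of_real y)" for y
    unfolding F_def sh.h_def sh.P_def J'_def[symmetric] exp_of_real[symmetric] by simp
  have F': "F y = sh.h (complex_of_real y + \<i> * complex_of_real 0)" for y by (simp add: F)
  have G: "G y = complex_of_real (sh.k y * measure ?N {..- (m * y)})" for y
    unfolding G_def sh.k_eq sh.P_def J'_def[symmetric] m_def[symmetric] Phi_of_real
    by (simp add: mult_ac)
  show "set_integrable lborel {0..} F"
    unfolding F' by (rule sh.set_integrable_h_shift)
  have Gi: "set_integrable lborel {0..} (\<lambda>t. sh.k t * measure ?N {..- (m * t)})"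
    unfolding m_def by (rule sh.set_integrable_k_tail)
  have Gs: "indicator {0..} y *\<^sub>R G y = complex_of_real (indicator {0..} y *\<^sub>R (sh.k y * measure ?N {..- (m * y)}))" for y
    by (simp add: G scaleR_conv_of_real)
  show "set_integrable lborel {0..} G"
    using Gi unfolding set_integrable_def Gs by (rule integrable_of_real)
  have IG: "(LBINT y:{0..}. G y) = complex_of_real (LBINT t:{0..}. sh.k t * measure ?N {..- (m * t)})"
    unfolding set_lebesgue_integral_def Gs by (rule integral_complex_of_real)
  have IF: "(LBINT y:{0..}. F y) = sh.H 0" unfolding F' sh.H_def ..
  have H0: "sh.H 0 = complex_of_real (Re (sh.H 0))"
    using sh.H_minus[of 0] by (simp add: complex_eq_iff)

  \<comment> \<open>In differences to \<open>u 0\<close> the shared covariance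
    \<open>1 / l k\<close> cancels and the part \<open>1 / l 0\<close> belonging to
    \<open>u 0\<close> becomes the shared one; only \<open>\<eta> k\<close> keeps
    \<open>1 / l k\<close>, as its own diagonal term.\<close>
  define \<eta> where "\<eta> j \<xi> = (if j = k then 0 else \<xi> j / sqrt (l j)) - \<xi> 0 / sqrt (l 0)" for j and \<xi> :: "nat \<Rightarrow> real"
  have g: "g_fun d l \<epsilon> = \<P>(\<omega> in mix. \<forall>j\<in>{1..d}. \<epsilon> j * \<eta> j \<omega> \<le> 0)"
  proof (rule g_fun_eqI)
    show "d > 0" using k by auto
    show "\<eta> i \<in> borel_measurable mix" if "i \<in> {1..d}" for i
    proof (cases "i = k")
      case True
      thus ?thesis using component_measurable_mix[OF J(2)] unfolding \<eta>_def[abs_def]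
        by (auto intro!: borel_measurable_divide)
    next
      case False
      hence "i \<in> J" using that by (auto simp: J_def)
      thus ?thesis using component_measurable_mix[OF J(2)] component_measurable_mix[of i] False unfolding \<eta>_def[abs_def]
        by (auto intro!: borel_measurable_divide borel_measurable_diff)
    qed
    fix a :: "nat \<Rightarrow> real"
    define A where "A = (\<Sum>i\<in>{1..d}. a i)"
    \<comment> \<open>Every \<open>\<eta> i\<close> subtracts \<open>u 0\<close>, so coordinate
      \<open>0\<close> collects \<open>- A\<close>. The coefficients then sum to
      \<open>- a k\<close>, which moves \<open>l k\<close> from the central to the diagonal
      place.\<close>
    define b where "b j = (if j = 0 then - A else a j)" for j
    have A: "A = a k + (\<Sum>i\<in>J'. a i)" using J by (simp add: A_def)
    have "(\<Sum>i\<in>{1..d}. a i * \<eta> i \<xi>) = (\<Sum>j\<in>J. b j * (\<xi> j / sqrt (l j)))" for \<xi>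
    proof -
      have "(\<Sum>i\<in>{1..d}. a i * \<eta> i \<xi>) = a k * \<eta> k \<xi> + (\<Sum>i\<in>J'. a i * \<eta> i \<xi>)"
        using J by simp
      also have "(\<Sum>i\<in>J'. a i * \<eta> i \<xi>) = (\<Sum>i\<in>J'. a i * (\<xi> i / sqrt (l i)) - a i * (\<xi> 0 / sqrt (l 0)))"
        using J by (intro sum.cong) (auto simp: \<eta>_def right_diff_distrib)
      also have "\<dots> = (\<Sum>i\<in>J'. a i * (\<xi> i / sqrt (l i))) - (\<Sum>i\<in>J'. a i) * (\<xi> 0 / sqrt (l 0))"
        by (simp only: sum_subtractf sum_distrib_right)
      also have "a k * \<eta> k \<xi> + \<dots> = (\<Sum>i\<in>J'. a i * (\<xi> i / sqrt (l i))) - A * (\<xi> 0 / sqrt (l 0))"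
        by (simp add: A \<eta>_def algebra_simps add_divide_distrib)
      also have "(\<Sum>i\<in>J'. a i * (\<xi> i / sqrt (l i))) = (\<Sum>i\<in>J'. b i * (\<xi> i / sqrt (l i)))"
        using J by (intro sum.cong) (auto simp: b_def)
      finally show ?thesis using J by (simp add: b_def)
    qed
    hence "(CLINT \<xi>|mix. cis (\<Sum>i\<in>{1..d}. a i * \<eta> i \<xi>)) = exp (- ((\<Sum>j\<in>J. b j)\<^sup>2 / l k + (\<Sum>j\<in>J. (b j)\<^sup>2 / l j)) / 2)"
      by (simp only: mix_char)
    moreover have "(\<Sum>j\<in>J. b j) = - a k"
    proof -
      have "(\<Sum>j\<in>J'. b j) = (\<Sum>j\<in>J'. a j)" using J by (intro sum.cong) (auto simp: b_def)
      thus ?thesis using J by (simp add: b_def A)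
    qed
    moreover have "(\<Sum>j\<in>J. (b j)\<^sup>2 / l j) = A\<^sup>2 / l 0 + (\<Sum>j\<in>J'. (a j)\<^sup>2 / l j)"
    proof -
      have "(\<Sum>j\<in>J'. (b j)\<^sup>2 / l j) = (\<Sum>j\<in>J'. (a j)\<^sup>2 / l j)" using J by (intro sum.cong) (auto simp: b_def)
      thus ?thesis using J by (simp add: b_def)
    qed
    moreover have "(\<Sum>j\<in>{1..d}. (a j)\<^sup>2 / l j) = (a k)\<^sup>2 / l k + (\<Sum>j\<in>J'. (a j)\<^sup>2 / l j)"
      using J by simp
    ultimately show "(CLINT \<xi>|mix. cis (\<Sum>i\<in>{1..d}. a i * \<eta> i \<xi>))
        = exp (- ((\<Sum>i\<in>{1..d}. a i)\<^sup>2 / l 0 + (\<Sum>i\<in>{1..d}. (a i)\<^sup>2 / l i)) / 2)"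
      unfolding A_def[symmetric] by (simp add: add.left_commute add.commute)
  qed (rule prob_space_mix)

  \<comment> \<open>Given \<open>\<xi> 0 = v\<close>, the condition on \<open>\<eta> j\<close> for
    \<open>j \<noteq> k\<close> is the half line \<open>\<epsilon> j * \<xi> j \<le> r j v\<close>,
    while the condition on \<open>\<eta> k\<close> only restricts the sign of
    \<open>v\<close>.\<close>
  define r where "r j v = \<epsilon> j * (sqrt (l j) * (v / sqrt (l 0)))" for j v
  define gg :: "real \<Rightarrow> complex" where "gg = indicator {v. - (\<epsilon> k * v) \<le> 0}"
  define f :: "nat \<Rightarrow> real \<Rightarrow> real \<Rightarrow> complex" where "f j v = indicator {y. \<epsilon> j * y \<le> r j v}" for j v
  define K where "K j v x = Phi (complex_of_real (r j v) - complex_of_real (\<epsilon> j) * (\<theta> * complex_of_real (sqrt (l j) * x)))" for j v x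
  define Hx where "Hx x = (CLINT v|?N. gg v * tilt1 0 x v * (\<Prod>j\<in>J - {0}. K j v x))" for x
  have [measurable]: "gg \<in> borel_measurable borel" unfolding gg_def by measurable
  have rm [measurable]: "r j \<in> borel_measurable borel" for j unfolding r_def[abs_def] by measurable
  have Km [measurable]: "(\<lambda>v. K j v x) \<in> borel_measurable borel" for j x unfolding K_def by measurable
  have fm: "(\<lambda>z. f j (fst z) (snd z)) \<in> borel_measurable (borel \<Otimes>\<^sub>M borel)" for j
  proof -
    have "{z :: real \<times> real. \<epsilon> j * snd z \<le> r j (fst z)} \<in> sets borel"
      unfolding r_def using l0 by (intro borel_closed closed_Collect_le continuous_intros) auto
    hence "(indicator {z :: real \<times> real. \<epsilon> j * snd z \<le> r j (fst z)} :: _ \<Rightarrow> complex) \<in> borel_measurable (borel \<Otimes>\<^sub>M borel)"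
      unfolding borel_prod by (rule borel_measurable_indicator)
    moreover have "(\<lambda>z. f j (fst z) (snd z)) = indicator {z :: real \<times> real. \<epsilon> j * snd z \<le> r j (fst z)}"
      by (auto simp: f_def indicator_def fun_eq_iff)
    ultimately show ?thesis by simp
  qed
  have Keq: "(CLINT y|?N. f j v y * tilt1 j x y) = K j v x" if "j \<in> J - {0}" for j v x
    unfolding f_def K_def using that ej J by (intro tilt1_halfline) auto
  note cond = mix_prod_given[where g = gg and f = f and K = K, OF J(2) _ _ fm _ Keq Km, folded Hx_def]
  have Hxi: "integrable ?N Hx"
    unfolding Hx_def[abs_def] by (rule cond(1)[unfolded Hx_def]) (auto simp: gg_def f_def indicator_def)
  have "complex_of_real (g_fun d l \<epsilon>) = (\<integral>\<xi>. gg (\<xi> 0) * (\<Prod>j\<in>J - {0}. f j (\<xi> 0) (\<xi> j)) \<partial>mix)"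
  proof -
    let ?A = "{\<xi>. - (\<epsilon> k * \<xi> 0) \<le> 0}" and ?B = "\<lambda>j. {\<xi>. \<epsilon> j * \<xi> j \<le> r j (\<xi> 0)}"
    have "(\<integral>\<xi>. gg (\<xi> 0) * (\<Prod>j\<in>J - {0}. f j (\<xi> 0) (\<xi> j)) \<partial>mix) = (CLINT \<xi>|mix. indicator ?A \<xi> * (\<Prod>j\<in>J'. indicator (?B j) \<xi>))"
      unfolding J(3) gg_def f_def by (intro Bochner_Integration.integral_cong refl) (auto simp: indicator_def)
    also have "\<dots> = complex_of_real (\<P>(\<xi> in mix. \<xi> \<in> ?A \<and> (\<forall>j\<in>J'. \<xi> \<in> ?B j)))"
      by (rule prod_indicator_expectation[OF J(4) prob_space_mix])
    also have "(\<lambda>\<xi>. \<xi> \<in> ?A \<and> (\<forall>j\<in>J'. \<xi> \<in> ?B j)) = (\<lambda>\<xi>. \<forall>j\<in>{1..d}. \<epsilon> j * \<eta> j \<xi> \<le> 0)"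
    proof
      fix \<xi> :: "nat \<Rightarrow> real"
      have "\<epsilon> k * \<eta> k \<xi> \<le> 0 \<longleftrightarrow> \<xi> \<in> ?A"
        using l0 by (simp add: \<eta>_def zero_le_divide_iff)
      moreover have "\<epsilon> j * \<eta> j \<xi> \<le> 0 \<longleftrightarrow> \<xi> \<in> ?B j" if "j \<in> J'" for j
      proof -
        have s: "sqrt (l j) > 0" using lpos[of j] that J by auto
        have "\<epsilon> j * \<eta> j \<xi> = (\<epsilon> j * \<xi> j - r j (\<xi> 0)) / sqrt (l j)"
          using that J s by (auto simp: \<eta>_def r_def field_simps)
        thus ?thesis using s by (simp add: divide_le_0_iff)
      qed
      ultimately show "(\<xi> \<in> ?A \<and> (\<forall>j\<in>J'. \<xi> \<in> ?B j)) = (\<forall>j\<in>{1..d}. \<epsilon> j * \<eta> j \<xi> \<le> 0)"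
        using J(8) by simp
    qed
    finally show ?thesis using g by simp
  qed
  also have "\<dots> = (CLINT x|?N. Hx x)"
    unfolding Hx_def[abs_def] by (rule cond(2)[unfolded Hx_def]) (auto simp: gg_def f_def indicator_def)
  finally have gH: "complex_of_real (g_fun d l \<epsilon>) = (CLINT x|?N. Hx x)" .

  have \<theta>: "\<theta> = \<i> / complex_of_real m"
  proof -
    have "csqrt (complex_of_real (l k)) = \<i> * complex_of_real m"
      using lk csqrt_of_real_nonpos[of "l k"] by (simp add: m_def)
    thus ?thesis using m by (simp add: \<theta>_def divide_simps)
  qed
  \<comment> \<open>The Jacobian \<open>sqrt (l 0)\<close> of the substitution below, times the
    constant of the normal density.\<close>
  define C where "C = sqrt (l 0 / (2 * pi))"
  \<comment> \<open>Substituting \<open>v = \<epsilon> k * sqrt (l 0) * y\<close> turns the half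
    line for \<open>v\<close> into \<open>y \<ge> 0\<close>. The imaginary shift is then the same
    for all factors and merges with \<open>y\<close> into one complex argument \<open>w y\<close>,
    so the integrand becomes \<open>h (w y)\<close>.\<close>
  have HxH: "Hx x = complex_of_real C * sh.H (- (\<epsilon> k * x / m))" for x
  proof -
    define w where "w y = complex_of_real y + \<i> * complex_of_real (- (\<epsilon> k * x / m))" for y
    have w: "w y = complex_of_real y - complex_of_real (\<epsilon> k) * \<theta> * complex_of_real x" for y
      using m by (simp add: w_def \<theta>)
    have s0: "complex_of_real (sqrt (l 0)) * complex_of_real (sqrt (l 0)) = complex_of_real (l 0)"
      using l0 by (simp flip: of_real_mult)
    have ekc: "complex_of_real (\<epsilon> k) * complex_of_real (\<epsilon> k) = 1"
      using ek2(1) by (metis of_real_1 of_real_mult)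
    let ?v = "\<lambda>y. 0 + (\<epsilon> k * sqrt (l 0)) * y"
    have integrand: "std_normal_density (?v y) *\<^sub>R (gg (?v y) * tilt1 0 x (?v y) * (\<Prod>j\<in>J'. K j (?v y) x))
        = complex_of_real (1 / sqrt (2 * pi)) * (indicator {0..} y *\<^sub>R sh.h (w y))" for y
    proof -
      have "gg (?v y) = indicator {0..} y"
      proof -
        have "- (\<epsilon> k * ?v y) = - (sqrt (l 0) * y)" using ek2 by (simp add: mult.assoc[symmetric])
        moreover have "- (sqrt (l 0) * y) \<le> 0 \<longleftrightarrow> y \<in> {0..}" using l0 by (simp add: zero_le_mult_iff)
        ultimately show ?thesis unfolding gg_def indicator_def mem_Collect_eq by (simp only:)
      qed
      moreover have "K j (?v y) x = Phi (complex_of_real (\<epsilon> k * \<epsilon> j * sqrt (l j)) * w y)" if "j \<in> J'" for j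
      proof -
        have r1: "r j (?v y) = \<epsilon> k * \<epsilon> j * sqrt (l j) * y" using l0 by (simp add: r_def)
        have r2: "complex_of_real (\<epsilon> j) * (\<theta> * complex_of_real (sqrt (l j) * x))
            = complex_of_real (\<epsilon> k * \<epsilon> j * sqrt (l j)) * (complex_of_real (\<epsilon> k) * \<theta> * complex_of_real x)"
        proof -
          have "complex_of_real (\<epsilon> k * \<epsilon> j * sqrt (l j)) * (complex_of_real (\<epsilon> k) * \<theta> * complex_of_real x)
             = (complex_of_real (\<epsilon> k) * complex_of_real (\<epsilon> k)) * (complex_of_real (\<epsilon> j) * (\<theta> * complex_of_real (sqrt (l j) * x)))"
            by (simp add: mult_ac)
          thus ?thesis unfolding ekc by (simp only: mult_1_left)
        qed
        show ?thesis unfolding K_def w r1 r2 by (simp only: right_diff_distrib of_real_mult)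
      qed
      hence "(\<Prod>j\<in>J'. K j (?v y) x) = sh.P (w y)"
        unfolding sh.P_def by (intro prod.cong) auto
      \<comment> \<open>Density and tilt complete the square in \<open>w y\<close>: by
        \<open>\<epsilon> k * \<epsilon> k = 1\<close> and
        \<open>\<theta>\<^sup>2 = 1 / l k\<close>, the \<open>x^2\<close> term of the square is the
        normalisation in \<open>tilt1\<close>.\<close>
      moreover have "complex_of_real (std_normal_density (?v y)) * tilt1 0 x (?v y)
          = complex_of_real (1 / sqrt (2 * pi)) * exp (- (complex_of_real (l 0) * (w y)\<^sup>2) / 2)"
      proof -
        have "(w y)\<^sup>2 = (complex_of_real y)\<^sup>2 - 2 * complex_of_real (\<epsilon> k) * \<theta> * complex_of_real x * complex_of_real y
            + (complex_of_real (\<epsilon> k) * complex_of_real (\<epsilon> k)) * \<theta>\<^sup>2 * (complex_of_real x)\<^sup>2"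
          unfolding w by (simp add: power2_eq_square algebra_simps)
        hence w2: "(w y)\<^sup>2 = (complex_of_real y)\<^sup>2 - 2 * complex_of_real (\<epsilon> k) * \<theta> * complex_of_real x * complex_of_real y
            + complex_of_real (1 / l k) * (complex_of_real x)\<^sup>2"
          unfolding ekc \<theta>_square by simp
        have v2: "(?v y)\<^sup>2 = l 0 * y\<^sup>2"
          using l0 ek by (auto simp: power_mult_distrib)
        have "complex_of_real (- ((?v y)\<^sup>2) / 2) + (\<theta> * complex_of_real (sqrt (l 0) * x) * complex_of_real (?v y) - complex_of_real (l 0 * x\<^sup>2 / (2 * l k)))
           = - (complex_of_real (l 0) * (w y)\<^sup>2) / 2"
        proof -
          have "\<theta> * complex_of_real (sqrt (l 0) * x) * complex_of_real (?v y)
             = (complex_of_real (sqrt (l 0)) * complex_of_real (sqrt (l 0))) * (complex_of_real (\<epsilon> k) * \<theta> * complex_of_real x * complex_of_real y)"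
            by (simp add: mult_ac)
          thus ?thesis unfolding v2 w2 s0 using lk by (simp add: field_simps)
        qed
        thus ?thesis
          unfolding std_normal_density_def tilt1_def of_real_mult mult.assoc exp_of_real[symmetric]
          by (simp only: exp_add[symmetric])
      qed
      ultimately show ?thesis unfolding sh.h_def scaleR_conv_of_real
        by (simp only: mult_ac of_real_indicator)
    qed
    have "Hx x = (LBINT v. std_normal_density v *\<^sub>R (gg v * tilt1 0 x v * (\<Prod>j\<in>J'. K j v x)))"
      unfolding Hx_def J(3) by (intro integral_density) auto
    also have "\<dots> = \<bar>\<epsilon> k * sqrt (l 0)\<bar> *\<^sub>R (LBINT y. std_normal_density (?v y) *\<^sub>R (gg (?v y) * tilt1 0 x (?v y) * (\<Prod>j\<in>J'. K j (?v y) x)))"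
      using ek2(2) l0 by (intro lborel_integral_real_affine) auto
    also have "\<dots> = sqrt (l 0) *\<^sub>R (complex_of_real (1 / sqrt (2 * pi)) * sh.H (- (\<epsilon> k * x / m)))"
      unfolding integrand integral_mult_right_zero sh.H_def set_lebesgue_integral_def w_def
      using ek2(3) l0 by (simp add: abs_mult)
    also have "\<dots> = complex_of_real C * sh.H (- (\<epsilon> k * x / m))"
      using l0 by (simp add: C_def scaleR_conv_of_real real_sqrt_divide)
    finally show ?thesis .
  qed
  \<comment> \<open>The sign \<open>- \<epsilon> k\<close> only reflects the argument, and
    \<open>Re H\<close> is even.\<close>
  have Rabs: "Re (sh.H (- (\<epsilon> k * x / m))) = Re (sh.H (x / m))" for x
  proof -
    have "\<bar>- (\<epsilon> k * x / m)\<bar> = \<bar>x / m\<bar>" using ek2(3) by (simp add: abs_mult)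
    thus ?thesis using sh.Re_H_abs by metis
  qed
  have C0: "C > 0" using l0 by (simp add: C_def)
  have ReHx: "Re (Hx x) = C * Re (sh.H (x / m))" for x
    unfolding HxH using Rabs[of x] by simp
  have "integrable ?N (\<lambda>x. 1 / C * Re (Hx x))" using Hxi by simp
  hence iR: "integrable ?N (\<lambda>x. Re (sh.H (x / sqrt (- l k))))"
    unfolding ReHx m_def using C0 by simp
  \<comment> \<open>The left side is real, so only \<open>Re H\<close> has to be averaged, and the
    integrability just obtained from the conditional formula is what the averaging lemma asks
    for.\<close>
  have "g_fun d l \<epsilon> = (\<integral>x. Re (Hx x) \<partial>?N)"
    using arg_cong[OF gH, of Re] Hxi by simp
  also have "\<dots> = C * (Re (sh.H 0) + 2 * (LBINT t:{0..}. sh.k t * measure ?N {..- (m * t)}))"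
    unfolding ReHx using sh.expectation_Re_H[OF iR] by (simp add: m_def)
  finally show "complex_of_real (g_fun d l \<epsilon>) =
            complex_of_real (sqrt (l 0 / (2 * pi))) * ((LBINT y:{0..}. F y) + 2 * (LBINT y:{0..}. G y))"
    unfolding IF IG using H0 by (simp add: C_def)
qed

theorem theorem1p5:
  fixes d :: nat and l \<epsilon> :: "nat \<Rightarrow> real"
  assumes eps: "\<forall>j\<in>{1..d}. \<epsilon> j \<in> {-1, 1}"
  shows
  "((\<forall>j\<in>{1..d}. l j > 0) \<and> (l 0 > 0 \<or> l 0 < - (\<Sum>j\<in>{1..d}. l j)) \<longrightarrow>
      (let F = (\<lambda>x::real. (\<Prod>j\<in>{1..d}. Phi (complex_of_real (\<epsilon> j) * sqrt_quot (l j) (l 0) * complex_of_real x))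
                 * complex_of_real (exp (- (x ^ 2) / 2)))
       in integrable lborel F \<and>
          complex_of_real (g_fun d l \<epsilon>) = 1 / complex_of_real (sqrt (2 * pi)) * (LBINT x. F x)))
   \<and>
   (\<forall>k\<in>{1..d}.
      (\<forall>i\<in>{0..d} - {k}. l i > 0) \<and> l k < 0 \<and> (\<Sum>i\<in>{0..d}. l i) < 0 \<longrightarrow>
      (let F = (\<lambda>y::real. complex_of_real (exp (- (l 0 * y ^ 2) / 2)) *
                 (\<Prod>j\<in>{1..d} - {k}. Phi (complex_of_real (\<epsilon> k * \<epsilon> j * sqrt (l j) * y))));
           G = (\<lambda>y::real. complex_of_real (exp (l 0 * y ^ 2 / 2)) *
                 Phi (complex_of_real (- (sqrt (- l k) * y))) *
                 complex_of_real (Im (\<Prod>j\<in>{1..d} - {k}. Phi (\<i> * complex_of_real (\<epsilon> k * \<epsilon> j * sqrt (l j) * y)))))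
       in set_integrable lborel {0..} F \<and> set_integrable lborel {0..} G \<and>
          complex_of_real (g_fun d l \<epsilon>) =
            complex_of_real (sqrt (l 0 / (2 * pi))) *
              ((LBINT y:{0..}. F y) + 2 * (LBINT y:{0..}. G y))))"
proof (intro conjI impI ballI)
  assume "(\<forall>j\<in>{1..d}. l j > 0) \<and> (l 0 > 0 \<or> l 0 < - (\<Sum>j\<in>{1..d}. l j))"
  with eps show "let F = (\<lambda>x::real. (\<Prod>j\<in>{1..d}. Phi (complex_of_real (\<epsilon> j) * sqrt_quot (l j) (l 0) * complex_of_real x))
                 * complex_of_real (exp (- (x ^ 2) / 2)))
       in integrable lborel F \<and>
          complex_of_real (g_fun d l \<epsilon>) = 1 / complex_of_real (sqrt (2 * pi)) * (LBINT x. F x)"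
    unfolding Let_def by (intro conjI g_fun_central_outlier) auto
next
  fix k
  assume k: "k \<in> {1..d}" and "(\<forall>i\<in>{0..d} - {k}. l i > 0) \<and> l k < 0 \<and> (\<Sum>i\<in>{0..d}. l i) < 0"
  hence "\<forall>i\<in>{0..d} - {k}. l i > 0" "l k < 0" "(\<Sum>i\<in>{0..d}. l i) < 0" by auto
  note outlier = g_fun_noncentral_outlier[OF eps k this]
  show "let F = (\<lambda>y::real. complex_of_real (exp (- (l 0 * y ^ 2) / 2)) *
                 (\<Prod>j\<in>{1..d} - {k}. Phi (complex_of_real (\<epsilon> k * \<epsilon> j * sqrt (l j) * y))));
           G = (\<lambda>y::real. complex_of_real (exp (l 0 * y ^ 2 / 2)) *
                 Phi (complex_of_real (- (sqrt (- l k) * y))) *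
                 complex_of_real (Im (\<Prod>j\<in>{1..d} - {k}. Phi (\<i> * complex_of_real (\<epsilon> k * \<epsilon> j * sqrt (l j) * y)))))
       in set_integrable lborel {0..} F \<and> set_integrable lborel {0..} G \<and>
          complex_of_real (g_fun d l \<epsilon>) =
            complex_of_real (sqrt (l 0 / (2 * pi))) *
              ((LBINT y:{0..}. F y) + 2 * (LBINT y:{0..}. G y))"
    unfolding Let_def by (intro conjI outlier)
qed

end
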